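(* For every positive integer $n$, $$c_1(K_{2,n})=\frac{3\lceil n/2\rceil-2}{2\lceil n/2\rceil-1},$$ where $K_{2,n}$ is the complete bipartite graph with parts of sizes $2$ and $n$.
   Context: For two metric spaces $(X,d_X)$ and $(Y,d_Y)$ and a map $f:X\to Y$, the distortion of $f$ is $$\mathrm{dist}(f)=\left(\sup_{d_X(x,y)\neq 0}\frac{d_Y(f(x),f(y))}{d_X(x,y)}\right)\cdot\left(\sup_{d_X(x,y)\neq 0}\frac{d_X(x,y)}{d_Y(f(x),f(y))}\right),$$ where a ratio in the second supremum is $+\infty$ if $f(x)=f(y)$ while $d_X(x,y)\neq 0$; thus $\mathrm{dist}(f)=+\infty$ if $f$ is not injective. If $X$ has only one point, set $\mathrm{dist}(f)=1$. For a finite connected graph $G$ and a weight function $w:E(G)\to[0,+\infty)$, the shortest path metric of $(G,w)$ assigns to vertices $u,v$ the minimum total weight $\sum_{e\in P}w(e)$ over all paths $P$ from $u$ to $v$ in $G$. Since weights may be zero, vertices at distance $0$ are identified, so that this is a metric on the resulting quotient of $V(G)$. The space $\ell_1$ is the space of absolutely summable real sequences with the metric induced by the norm $\|\cdot\|_1$. Let $c_1(G,w)$ be the minimum distortion of a map from the shortest path metric space of $(G,w)$ into $\ell_1$, and let $$c_1(G)=\sup_{w:E(G)\to[0,+\infty)}c_1(G,w).$$ *)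

theory Defs
  imports "HOL-Analysis.Analysis" "Graph_Theory.Graph_Theory"
begin

text \<open>
  The first factor is \<open>0\<close> for a constant map, and \<open>0 * \<infinity> = 0\<close> in \<^typ>\<open>ennreal\<close>; hence the
  value \<open>\<infinity>\<close> for non-injective maps is given explicitly. For injective maps into a metric space
  all denominators are nonzero.
\<close>

definition distortion ::
    "'a set \<Rightarrow> ('a \<Rightarrow> 'a \<Rightarrow> real) \<Rightarrow> ('b \<Rightarrow> 'b \<Rightarrow> real) \<Rightarrow> ('a \<Rightarrow> 'b) \<Rightarrow> ennreal" where
  "distortion X dX dY f =
    (if is_singleton X then 1
     else if \<not> inj_on f X then \<infinity>
     else (SUP (x, y) \<in> {(x, y) \<in> X \<times> X. dX x y \<noteq> 0}. ennreal (dY (f x) (f y)) / ennreal (dX x y))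
        * (SUP (x, y) \<in> {(x, y) \<in> X \<times> X. dX x y \<noteq> 0}. ennreal (dX x y) / ennreal (dY (f x) (f y))))"

definition ell1 :: "(nat \<Rightarrow> real) set" where
  "ell1 = {x. summable (\<lambda>i. \<bar>x i\<bar>)}"

definition ell1_dist :: "(nat \<Rightarrow> real) \<Rightarrow> (nat \<Rightarrow> real) \<Rightarrow> real" where
  "ell1_dist x y = (\<Sum>i. \<bar>x i - y i\<bar>)"

text \<open>
  Undirected graphs are the symmetric digraphs of \<^locale>\<open>graph\<close>. An undirected edge is the set of
  its two end points, represented by a pair of opposite arcs. A weight is a function on edges, so
  that both arcs get the same weight; its values on sets that are not edges are never used.
\<close>

definition edges :: "('a, 'b) pre_digraph \<Rightarrow> 'a set set" where
  "edges G = {{u, v} | u v. (u, v) \<in> arcs_ends G}"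

definition path_weight :: "('a, 'b) pre_digraph \<Rightarrow> ('a set \<Rightarrow> real) \<Rightarrow> 'b list \<Rightarrow> real" where
  "path_weight G w p = (\<Sum>a\<leftarrow>p. w {tail G a, head G a})"

text \<open>
  In a finite graph there are finitely many paths between two vertices, and at least one if the
  graph is connected, so the minimum exists.
\<close>

definition sp_dist :: "('a, 'b) pre_digraph \<Rightarrow> ('a set \<Rightarrow> real) \<Rightarrow> 'a \<Rightarrow> 'a \<Rightarrow> real" where
  "sp_dist G w u v = Min {path_weight G w p | p. pre_digraph.apath G u p v}"

definition sp_points :: "('a, 'b) pre_digraph \<Rightarrow> ('a set \<Rightarrow> real) \<Rightarrow> 'a set set" where
  "sp_points G w = verts G // {(u, v) \<in> verts G \<times> verts G. sp_dist G w u v = 0}"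

text \<open>
  For nonnegative weights on a connected graph, \<^const>\<open>sp_dist\<close> is a pseudometric, hence constant
  on the product of two classes, and the image below is a singleton.
\<close>

definition sp_quot_dist ::
    "('a, 'b) pre_digraph \<Rightarrow> ('a set \<Rightarrow> real) \<Rightarrow> 'a set \<Rightarrow> 'a set \<Rightarrow> real" where
  "sp_quot_dist G w A B = the_elem ((\<lambda>(u, v). sp_dist G w u v) ` (A \<times> B))"

definition c1_weighted :: "('a, 'b) pre_digraph \<Rightarrow> ('a set \<Rightarrow> real) \<Rightarrow> ennreal" where
  "c1_weighted G w =
    (INF f \<in> sp_points G w \<rightarrow> ell1. distortion (sp_points G w) (sp_quot_dist G w) ell1_dist f)"

definition c1 :: "('a, 'b) pre_digraph \<Rightarrow> ennreal" where
  "c1 G = (SUP w \<in> {w. \<forall>e \<in> edges G. 0 \<le> w e}. c1_weighted G w)"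

end

theory Submission
  imports Defs
begin

text \<open>
  Write $k = \lceil n/2 \rceil$, call the two vertices of the small part the hubs $s$ and $t$, and let
  $X$ be the other part.

  Lower bound. Every finite set of points of \<open>\<ell>\<^sub>1\<close> satisfies the hypermetric inequalities
  $\sum_{u,v} b_u b_v\, d(u,v) \le 0$ for integers $b$ of sum 1: a set of reals is, metrically, a
  nonnegative combination of cuts, and for one cut the sum is $2c(1-c)$ with an integer $c$
  (\<open>cut_cone_hypermetric\<close>, \<open>ell1_hypermetric\<close>). Take unit weights, $b = 1$ on $2k-1$ vertices of $X$
  and $b = 1-k$ on both hubs. The pairs with $b_u b_v > 0$ are at distance 2 and the others at
  distance 1, and comparing the two parts of the sum gives the ratio $(3k-2)/(2k-1)$
  (\<open>hypermetric_distortion_bound\<close>).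

  Upper bound. Let $D = d(s,t)$. A vertex $x$ of $X$ behaves like a pendant edge of some length
  $e_x$ attached at the position $p_x \in [0,D]$ of its own private $s$-$t$ path of length $D$; the
  distance of two vertices of $X$ is the shorter of the routes over $s$ and over $t$. Choose a
  random set $A$ of $k$ among $2k$ paths. Map $s$ and $t$ to antipodal points of a circle of
  circumference $2D$, the paths in $A$ to one half circle and the other paths to the opposite half.
  Run through a path in $A$ at speed 0 up to its middle and then at speed 2, and through a path not
  in $A$ at speed 2 and then at speed 0, so that on average every path is traversed at speed 1.
  If two vertices fall on opposite sides (probability $k/(2k-1)$), their distance is preserved on
  average; if they fall on the same side, what is lost is repaid by a star metric with legs
  $\min(p_x, D-p_x)$. Mixing the circles with weight $(2k-1)/(3k-2)$ and the star with weight
  $(k-1)/(3k-2)$ increases no distance and keeps at least the fraction $(2k-1)/(3k-2)$ of it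
  (\<open>two_hub_metric_near_cut_cone\<close>). Circle metrics and stars are combinations of cuts
  (\<open>cut_cone_circle\<close>, \<open>cut_cone_star\<close>), hence so is the mixture, and it embeds isometrically into
  \<open>\<ell>\<^sub>1\<close> (\<open>cut_cone_embeds_ell1\<close>).
\<close>

section \<open>The cut cone\<close>

definition cut_dist :: "'v set \<Rightarrow> 'v \<Rightarrow> 'v \<Rightarrow> real" where
  "cut_dist C u v = (if u \<in> C \<longleftrightarrow> v \<in> C then 0 else 1)"

text \<open>
  On a finite set the metrics of this form are exactly those that embed isometrically into
  \<open>\<ell>\<^sub>1\<close>. Being closed under sums and nonnegative multiples by mere addition of coefficients, they
  are more convenient to combine than embeddings.
\<close>

definition cut_cone :: "'v set \<Rightarrow> ('v \<Rightarrow> 'v \<Rightarrow> real) \<Rightarrow> bool" where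
  "cut_cone V d \<longleftrightarrow> (\<exists>c. (\<forall>C. 0 \<le> c C) \<and>
     (\<forall>u\<in>V. \<forall>v\<in>V. d u v = (\<Sum>C\<in>Pow V. c C * cut_dist C u v)))"

lemma cut_coneI:
  assumes "\<And>C. 0 \<le> c C"
    and "\<And>u v. u \<in> V \<Longrightarrow> v \<in> V \<Longrightarrow> d u v = (\<Sum>C\<in>Pow V. c C * cut_dist C u v)"
  shows "cut_cone V d"
  using assms unfolding cut_cone_def by blast

lemma cut_coneE:
  assumes "cut_cone V d"
  obtains c where "\<And>C. 0 \<le> c C"
    "\<And>u v. u \<in> V \<Longrightarrow> v \<in> V \<Longrightarrow> d u v = (\<Sum>C\<in>Pow V. c C * cut_dist C u v)"
  using assms unfolding cut_cone_def by blast

lemma cut_cone_cong: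
  assumes "cut_cone V d" "\<And>u v. u \<in> V \<Longrightarrow> v \<in> V \<Longrightarrow> d u v = d' u v"
  shows "cut_cone V d'"
  using assms unfolding cut_cone_def by metis

lemma cut_cone_cut:
  assumes "finite V"
  shows "cut_cone V (cut_dist C)"
proof (rule cut_coneI[where c = "\<lambda>B. if B = C \<inter> V then 1 else 0"])
  fix u v assume "u \<in> V" "v \<in> V"
  have "(\<Sum>B\<in>Pow V. (if B = C \<inter> V then 1 else 0) * cut_dist B u v) = cut_dist (C \<inter> V) u v"
    using assms by (subst sum.remove[of _ "C \<inter> V"]) (auto intro!: sum.neutral)
  also have "\<dots> = cut_dist C u v" using \<open>u \<in> V\<close> \<open>v \<in> V\<close> by (simp add: cut_dist_def)
  finally show "cut_dist C u v = (\<Sum>B\<in>Pow V. (if B = C \<inter> V then 1 else 0) * cut_dist B u v)" ..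
qed simp

lemma cut_cone_add:
  assumes "cut_cone V d" "cut_cone V d'"
  shows "cut_cone V (\<lambda>u v. d u v + d' u v)"
proof -
  from assms obtain c c' where
    c: "\<And>C. 0 \<le> c C" "\<And>u v. u \<in> V \<Longrightarrow> v \<in> V \<Longrightarrow> d u v = (\<Sum>C\<in>Pow V. c C * cut_dist C u v)" and
    c': "\<And>C. 0 \<le> c' C" "\<And>u v. u \<in> V \<Longrightarrow> v \<in> V \<Longrightarrow> d' u v = (\<Sum>C\<in>Pow V. c' C * cut_dist C u v)"
    by (elim cut_coneE) blast
  show ?thesis
    by (rule cut_coneI[where c = "\<lambda>C. c C + c' C"]) (simp_all add: c c' sum.distrib distrib_right)
qed

lemma cut_cone_scale:
  assumes "cut_cone V d" "0 \<le> a"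
  shows "cut_cone V (\<lambda>u v. a * d u v)"
proof -
  from assms obtain c where
    c: "\<And>C. 0 \<le> c C" "\<And>u v. u \<in> V \<Longrightarrow> v \<in> V \<Longrightarrow> d u v = (\<Sum>C\<in>Pow V. c C * cut_dist C u v)"
    by (elim cut_coneE) blast
  show ?thesis
    by (rule cut_coneI[where c = "\<lambda>C. a * c C"]) (simp_all add: c assms sum_distrib_left mult.assoc)
qed

lemma cut_cone_zero: "cut_cone V (\<lambda>u v. 0)"
  by (rule cut_coneI[where c = "\<lambda>C. 0"]) simp_all

lemma cut_cone_sum:
  assumes "\<And>i. i \<in> I \<Longrightarrow> cut_cone V (d i)"
  shows "cut_cone V (\<lambda>u v. \<Sum>i\<in>I. d i u v)"
  using assms
  by (induction I rule: infinite_finite_induct) (auto intro: cut_cone_zero cut_cone_add)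

lemma cut_cone_triangle:
  assumes "cut_cone V d" "u \<in> V" "v \<in> V" "x \<in> V"
  shows "d u x \<le> d u v + d v x"
proof -
  from assms obtain c where
    c: "\<And>C. 0 \<le> c C" "\<And>u v. u \<in> V \<Longrightarrow> v \<in> V \<Longrightarrow> d u v = (\<Sum>C\<in>Pow V. c C * cut_dist C u v)"
    by (elim cut_coneE) blast
  have "c C * cut_dist C u x \<le> c C * cut_dist C u v + c C * cut_dist C v x" for C
    using c(1)[of C] by (auto simp: cut_dist_def)
  then show ?thesis using assms by (simp add: c sum_mono flip: sum.distrib)
qed

lemma cut_cone_sym:
  assumes "cut_cone V d" "u \<in> V" "v \<in> V"
  shows "d u v = d v u"
proof -
  have "cut_dist C u v = cut_dist C v u" for C by (auto simp: cut_dist_def)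
  then show ?thesis using assms by (elim cut_coneE) simp
qed

text \<open>
  The leaf $x$ of a star with legs $g$ is cut off by the singleton $\{x\}$, with weight $g(x)$.
\<close>

lemma cut_cone_star:
  assumes "finite V" "\<And>v. v \<in> V \<Longrightarrow> 0 \<le> g v"
  shows "cut_cone V (\<lambda>u v. if u = v then 0 else g u + g v)"
proof (rule cut_cone_cong)
  show "cut_cone V (\<lambda>u v. \<Sum>x\<in>V. g x * cut_dist {x} u v)"
    using assms by (intro cut_cone_sum cut_cone_scale cut_cone_cut)
  fix u v assume uv: "u \<in> V" "v \<in> V"
  have "(\<Sum>x\<in>V. g x * cut_dist {x} u v) = (\<Sum>x\<in>{u, v}. g x * cut_dist {x} u v)"
    using uv assms by (intro sum.mono_neutral_right) (auto simp: cut_dist_def)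
  then show "(\<Sum>x\<in>V. g x * cut_dist {x} u v) = (if u = v then 0 else g u + g v)"
    by (simp add: cut_dist_def)
qed

text \<open>
  Sort the points of the measure space by the set $C$ of those $v$ with the point in $S_v$. The
  points of sort $C$ contribute to the symmetric difference of $S_u$ and $S_v$ exactly if $C$
  separates $u$ from $v$, so the coefficient of the cut $C$ is the measure of the atom of sort $C$.
\<close>

lemma cut_cone_measure:
  assumes fin: "finite V" and S: "\<And>v. v \<in> V \<Longrightarrow> S v \<in> fmeasurable M"
  shows "cut_cone V (\<lambda>u v. measure M ((S u - S v) \<union> (S v - S u)))"
proof (rule cut_coneI)
  define U where "U = (\<Union>v\<in>V. S v)"
  define T where "T x = {v \<in> V. x \<in> S v}" for x
  define atom where "atom C = {x \<in> U. T x = C}" for C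
  have U: "U \<in> fmeasurable M" unfolding U_def using fin S by (intro fmeasurable.finite_UN) auto
  have atom: "atom C \<in> fmeasurable M" if "C \<subseteq> V" for C
  proof -
    have "T x = C \<longleftrightarrow> (\<forall>v\<in>V - C. x \<notin> S v) \<and> (\<forall>v\<in>C. x \<in> S v)" for x
      using that unfolding T_def by blast
    then have "atom C = U - (\<Union>v\<in>V - C. S v) - (\<Union>v\<in>C. U - S v)"
      unfolding atom_def by blast
    also have "\<dots> \<in> fmeasurable M"
    proof (intro fmeasurable.Diff fmeasurable.finite_UN U)
      show "finite C" using that fin by (rule finite_subset)
      show "finite (V - C)" using fin by simp
    qed (use that S in auto)
    finally show ?thesis .
  qed
  fix u v assume uv: "u \<in> V" "v \<in> V"
  define P where "P = {C \<in> Pow V. u \<in> C \<longleftrightarrow> v \<notin> C}"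
  have "finite P" "P \<subseteq> Pow V" using fin by (auto simp: P_def)
  then have "(\<Sum>C\<in>Pow V. measure M (atom C) * cut_dist C u v) = (\<Sum>C\<in>P. measure M (atom C))"
    using fin by (intro sum.mono_neutral_cong_right) (auto simp: cut_dist_def P_def)
  also have "\<dots> = measure M (\<Union>C\<in>P. atom C)"
  proof (rule measure_UNION'[symmetric])
    show "atom C \<in> fmeasurable M" if "C \<in> P" for C
      using that \<open>P \<subseteq> Pow V\<close> atom by blast
    show "pairwise (\<lambda>C C'. disjnt (atom C) (atom C')) P"
      by (auto simp: pairwise_def disjnt_def atom_def)
  qed (fact \<open>finite P\<close>)
  also have "(\<Union>C\<in>P. atom C) = {x \<in> U. u \<in> T x \<longleftrightarrow> v \<notin> T x}"
  proof -
    have "T x \<in> Pow V" for x by (auto simp: T_def)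
    then show ?thesis unfolding P_def atom_def by blast
  qed
  also have "\<dots> = (S u - S v) \<union> (S v - S u)"
    using uv unfolding T_def U_def by blast
  finally show "measure M ((S u - S v) \<union> (S v - S u)) = (\<Sum>C\<in>Pow V. measure M (atom C) * cut_dist C u v)" ..
qed simp

text \<open>
  The geodesic distance on a circle of circumference $2D$, parametrised by $[-D, D]$ with both ends
  identified.
\<close>

definition circle_dist :: "real \<Rightarrow> real \<Rightarrow> real \<Rightarrow> real" where
  "circle_dist D x y = min \<bar>x - y\<bar> (2 * D - \<bar>x - y\<bar>)"

text \<open>
  Every diameter of the circle cuts it into two half circles, and the distance of two points is
  the measure of the set of diameters that separate them. The diameters are parametrised by $[0,D)$;
  $S_x$ consists of those that separate $x$ from 0: an initial interval for points on the positive
  side, a final interval for points on the negative side.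
\<close>

lemma cut_cone_circle:
  assumes fin: "finite V" and z: "\<And>v. v \<in> V \<Longrightarrow> \<bar>z v\<bar> \<le> D"
  shows "cut_cone V (\<lambda>u v. circle_dist D (z u) (z v))"
proof (rule cut_cone_cong)
  define S where "S x = (if 0 \<le> x then {0..<x} else {D + x..<D})" for x :: real
  have "S x \<in> fmeasurable lborel" for x
    by (rule fmeasurableI) (auto simp: S_def)
  then show "cut_cone V (\<lambda>u v. measure lborel ((S (z u) - S (z v)) \<union> (S (z v) - S (z u))))"
    by (intro cut_cone_measure fin)
  have le: "measure lborel ((S x - S y) \<union> (S y - S x)) = circle_dist D x y"
    if "\<bar>x\<bar> \<le> D" "\<bar>y\<bar> \<le> D" "x \<le> y" for x y
  proof -
    have two: "measure lborel ({a..<b} \<union> {c..<d}) = (b - a) + (d - c)"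
      if "a \<le> b" "b \<le> c" "c \<le> d" for a b c d :: real
      using that by (subst measure_Union) auto
    consider "0 \<le> x" | "y < 0" | "x < 0" "0 \<le> y" "y \<le> D + x" | "x < 0" "0 \<le> y" "D + x < y"
      by linarith
    then show ?thesis
    proof cases
      case 1
      then have "(S x - S y) \<union> (S y - S x) = {x..<y}" using that by (auto simp: S_def)
      then show ?thesis using that 1 by (simp add: circle_dist_def)
    next
      case 2
      then have "(S x - S y) \<union> (S y - S x) = {D + x..<D + y}" using that by (auto simp: S_def)
      then show ?thesis using that 2 by (simp add: circle_dist_def)
    next
      case 3
      then have "(S x - S y) \<union> (S y - S x) = {0..<y} \<union> {D + x..<D}" using that by (auto simp: S_def)
      then show ?thesis using that 3 two[of 0 y "D + x" D] by (simp add: circle_dist_def)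
    next
      case 4
      then have "(S x - S y) \<union> (S y - S x) = {0..<D + x} \<union> {y..<D}" using that by (auto simp: S_def)
      then show ?thesis using that 4 two[of 0 "D + x" y D] by (simp add: circle_dist_def)
    qed
  qed
  fix u v assume "u \<in> V" "v \<in> V"
  then have "\<bar>z u\<bar> \<le> D" "\<bar>z v\<bar> \<le> D" using z by auto
  then show "measure lborel ((S (z u) - S (z v)) \<union> (S (z v) - S (z u))) = circle_dist D (z u) (z v)"
    using le[of "z u" "z v"] le[of "z v" "z u"]
    by (cases "z u \<le> z v") (auto simp: circle_dist_def Un_commute abs_minus_commute)
qed

text \<open>
  A bounded part of the line is isometric to an arc that is at most half of a sufficiently large
  circle.
\<close>

lemma cut_cone_line:
  fixes z :: "'v \<Rightarrow> real"
  assumes fin: "finite V"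
  shows "cut_cone V (\<lambda>u v. \<bar>z u - z v\<bar>)"
proof (rule cut_cone_cong)
  define M where "M = (\<Sum>v\<in>V. \<bar>z v\<bar>)"
  have M: "\<bar>z v\<bar> \<le> M" if "v \<in> V" for v
    unfolding M_def using fin that by (intro member_le_sum) auto
  then show "cut_cone V (\<lambda>u v. circle_dist (2 * M) (z u) (z v))"
    by (intro cut_cone_circle fin) force
  fix u v assume "u \<in> V" "v \<in> V"
  with M[of u] M[of v] show "circle_dist (2 * M) (z u) (z v) = \<bar>z u - z v\<bar>"
    by (simp add: circle_dist_def)
qed

section \<open>Hypermetric inequalities and embeddings into \<open>\<ell>\<^sub>1\<close>\<close>

text \<open>
  For the cut $C$ the sum is $2c(1-c)$ where $c$ is the sum of $b$ over $C$ (here $s$), and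
  $c(c-1) \ge 0$ because $c$ is an integer.
\<close>

lemma cut_cone_hypermetric:
  fixes b :: "'v \<Rightarrow> int"
  assumes fin: "finite V" and d: "cut_cone V d" and b: "(\<Sum>v\<in>V. b v) = 1"
  shows "(\<Sum>u\<in>V. \<Sum>v\<in>V. real_of_int (b u * b v) * d u v) \<le> 0"
proof -
  have cut: "(\<Sum>u\<in>V. \<Sum>v\<in>V. real_of_int (b u * b v) * cut_dist C u v) \<le> 0" for C
  proof -
    \<comment> \<open>the cut metric is \<open>i u + i v - 2 * i u * i v\<close>\<close>
    define i where "i u = (if u \<in> C then 1 else 0 :: int)" for u
    define s where "s = (\<Sum>u\<in>V. b u * i u)"
    have "(\<Sum>u\<in>V. \<Sum>v\<in>V. real_of_int (b u * b v) * cut_dist C u v)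
      = real_of_int (\<Sum>u\<in>V. \<Sum>v\<in>V. (b u * i u) * b v + b u * (b v * i v) - 2 * ((b u * i u) * (b v * i v)))"
      unfolding of_int_sum by (intro sum.cong refl) (auto simp: cut_dist_def i_def)
    also have "(\<Sum>u\<in>V. \<Sum>v\<in>V. (b u * i u) * b v + b u * (b v * i v) - 2 * ((b u * i u) * (b v * i v)))
       = s * (\<Sum>v\<in>V. b v) + (\<Sum>v\<in>V. b v) * s - 2 * (s * s)"
      by (simp add: sum.distrib sum_subtractf s_def sum_product flip: sum_distrib_left)
    also have "\<dots> = - 2 * (s * (s - 1))" by (simp add: b algebra_simps)
    also have "real_of_int \<dots> \<le> 0"
    proof -
      have "0 \<le> s * (s - 1)" by (cases "s \<le> 0") (auto simp: mult_nonpos_nonpos)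
      then show ?thesis by linarith
    qed
    finally show ?thesis .
  qed
  from d obtain c where
    c: "\<And>C. 0 \<le> c C" "\<And>u v. u \<in> V \<Longrightarrow> v \<in> V \<Longrightarrow> d u v = (\<Sum>C\<in>Pow V. c C * cut_dist C u v)"
    by (elim cut_coneE) blast
  have "(\<Sum>u\<in>V. \<Sum>v\<in>V. real_of_int (b u * b v) * d u v)
      = (\<Sum>u\<in>V. \<Sum>v\<in>V. \<Sum>C\<in>Pow V. c C * (real_of_int (b u * b v) * cut_dist C u v))"
    by (intro sum.cong refl) (simp add: c sum_distrib_left mult.left_commute)
  also have "\<dots> = (\<Sum>u\<in>V. \<Sum>C\<in>Pow V. \<Sum>v\<in>V. c C * (real_of_int (b u * b v) * cut_dist C u v))"
    by (intro sum.cong refl sum.swap)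
  also have "\<dots> = (\<Sum>C\<in>Pow V. \<Sum>u\<in>V. \<Sum>v\<in>V. c C * (real_of_int (b u * b v) * cut_dist C u v))"
    by (rule sum.swap)
  also have "\<dots> = (\<Sum>C\<in>Pow V. c C * (\<Sum>u\<in>V. \<Sum>v\<in>V. real_of_int (b u * b v) * cut_dist C u v))"
    by (simp only: sum_distrib_left)
  also have "\<dots> \<le> 0"
    by (intro sum_nonpos mult_nonneg_nonpos c cut)
  finally show ?thesis .
qed

lemma ell1_dist_summable:
  assumes "x \<in> ell1" "y \<in> ell1"
  shows "summable (\<lambda>i. \<bar>x i - y i\<bar>)"
proof (rule summable_comparison_test')
  show "summable (\<lambda>i. \<bar>x i\<bar> + \<bar>y i\<bar>)" using assms by (intro summable_add) (auto simp: ell1_def)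
qed (auto intro: abs_triangle_ineq4)

lemma ell1_dist_pos:
  assumes "x \<in> ell1" "y \<in> ell1" "x \<noteq> y"
  shows "0 < ell1_dist x y"
proof -
  from assms obtain i where "x i \<noteq> y i" by auto
  then show ?thesis
    unfolding ell1_dist_def by (intro suminf_pos2[where i = i] ell1_dist_summable assms) auto
qed

text \<open>
  The inequality is linear in the metric and holds in each coordinate, where the points lie on a
  line.
\<close>

lemma ell1_hypermetric:
  fixes b :: "'v \<Rightarrow> int"
  assumes fin: "finite V" and f: "\<And>v. v \<in> V \<Longrightarrow> f v \<in> ell1" and b: "(\<Sum>v\<in>V. b v) = 1"
  shows "(\<Sum>u\<in>V. \<Sum>v\<in>V. real_of_int (b u * b v) * ell1_dist (f u) (f v)) \<le> 0"
proof (rule sums_le)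
  show "(\<lambda>i. \<Sum>u\<in>V. \<Sum>v\<in>V. real_of_int (b u * b v) * \<bar>f u i - f v i\<bar>) sums
      (\<Sum>u\<in>V. \<Sum>v\<in>V. real_of_int (b u * b v) * ell1_dist (f u) (f v))"
    unfolding ell1_dist_def
    by (intro sums_sum sums_mult summable_sums ell1_dist_summable f)
  show "(\<Sum>u\<in>V. \<Sum>v\<in>V. real_of_int (b u * b v) * \<bar>f u i - f v i\<bar>) \<le> 0" for i
    by (rule cut_cone_hypermetric[OF fin cut_cone_line[OF fin, of "\<lambda>v. f v i"] b])
qed simp

text \<open>
  One coordinate for each cut: its coefficient on one side, 0 on the other.
\<close>

lemma cut_cone_embeds_ell1:
  assumes fin: "finite V" and d: "cut_cone V d"
  obtains f where "\<And>v. f v \<in> ell1"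
    "\<And>u v. u \<in> V \<Longrightarrow> v \<in> V \<Longrightarrow> ell1_dist (f u) (f v) = d u v"
proof -
  from d obtain c where
    c: "\<And>C. 0 \<le> c C" "\<And>u v. u \<in> V \<Longrightarrow> v \<in> V \<Longrightarrow> d u v = (\<Sum>C\<in>Pow V. c C * cut_dist C u v)"
    by (elim cut_coneE) blast
  obtain e :: "nat \<Rightarrow> 'a set" and N where e: "bij_betw e {..<N} (Pow V)"
    using ex_bij_betw_nat_finite[of "Pow V"] fin by (auto simp: lessThan_atLeast0)
  define f where "f v i = (if i < N \<and> v \<in> e i then c (e i) else 0)" for v i
  have "f v \<in> ell1" for v
    unfolding ell1_def by (auto intro!: summable_finite[of "{..<N}"] simp: f_def split: if_splits)
  moreover have "ell1_dist (f u) (f v) = d u v" if "u \<in> V" "v \<in> V" for u v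
  proof -
    have "ell1_dist (f u) (f v) = (\<Sum>i<N. \<bar>f u i - f v i\<bar>)"
      unfolding ell1_dist_def by (rule suminf_finite) (auto simp: f_def)
    also have "\<dots> = (\<Sum>i<N. c (e i) * cut_dist (e i) u v)"
      using c(1) by (intro sum.cong refl) (auto simp: f_def cut_dist_def)
    also have "\<dots> = d u v"
      using sum.reindex_bij_betw[OF e, of "\<lambda>C. c C * cut_dist C u v"] c(2)[OF that] by simp
    finally show ?thesis .
  qed
  ultimately show thesis using that by blast
qed

section \<open>Random balanced partitions\<close>

text \<open>
  For two indices inside the $2k$-set, a balanced set that contains just one of them is determined
  by $k-1$ further elements, and one that contains neither by $k$. The sets containing both are
  the complements of those containing neither; counting them so avoids the number $k-2$, which
  makes no sense for $k = 1$.
\<close>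

lemma sum_balanced_subsets:
  fixes F :: "bool \<Rightarrow> bool \<Rightarrow> real"
  assumes k: "1 \<le> k" and ij: "i < 2 * k" "j < 2 * k" "i \<noteq> j"
  shows "(\<Sum>A | A \<subseteq> {..<2 * k} \<and> card A = k. F (i \<in> A) (j \<in> A))
    = real ((2 * k - 2) choose (k - 1)) * (F True False + F False True)
      + real ((2 * k - 2) choose k) * (F True True + F False False)"
proof -
  define P where "P = {A. A \<subseteq> {..<2 * k} \<and> card A = k}"
  define N where "N a b = card {A \<in> P. (i \<in> A) = a \<and> (j \<in> A) = b}" for a b
  define R where "R = {..<2 * k} - {i, j}"
  have finR: "finite R" and cardR: "card R = 2 * k - 2"
    using ij by (simp_all add: R_def card_Diff_subset)
  have finP: "finite P" by (simp add: P_def)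
  have FF: "N False False = ((2 * k - 2) choose k)"
  proof -
    have "{A \<in> P. (i \<in> A) = False \<and> (j \<in> A) = False} = {B. B \<subseteq> R \<and> card B = k}"
      by (auto simp: P_def R_def)
    then show ?thesis using n_subsets[OF finR, of k] cardR by (simp add: N_def)
  qed
  have one: "card {A \<in> P. x \<in> A \<and> y \<notin> A} = ((2 * k - 2) choose (k - 1))"
    if xy: "{x, y} = {i, j}" "x \<noteq> y" for x y
  proof -
    have R: "R = {..<2 * k} - {x, y}" "x < 2 * k" using xy ij by (auto simp: R_def)
    have "bij_betw (insert x) {B. B \<subseteq> R \<and> card B = k - 1} {A \<in> P. x \<in> A \<and> y \<notin> A}"
    proof (rule bij_betw_byWitness[where f' = "\<lambda>A. A - {x}"])
      show "insert x ` {B. B \<subseteq> R \<and> card B = k - 1} \<subseteq> {A \<in> P. x \<in> A \<and> y \<notin> A}"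
      proof (rule image_subsetI)
        fix B assume "B \<in> {B. B \<subseteq> R \<and> card B = k - 1}"
        then have B: "B \<subseteq> R" "card B = k - 1" by auto
        then have "x \<notin> B" "finite B" using R finR by (auto dest: finite_subset)
        moreover have "y \<notin> insert x B" using B R xy by auto
        ultimately show "insert x B \<in> {A \<in> P. x \<in> A \<and> y \<notin> A}" using B R k by (auto simp: P_def)
      qed
      show "(\<lambda>A. A - {x}) ` {A \<in> P. x \<in> A \<and> y \<notin> A} \<subseteq> {B. B \<subseteq> R \<and> card B = k - 1}"
        using R by (auto simp: P_def)
    qed (use R in auto)
    from bij_betw_same_card[OF this] show ?thesis
      using n_subsets[OF finR, of "k - 1"] cardR by simp
  qed
  have TF: "N True False = ((2 * k - 2) choose (k - 1))"
    using one[of i j] ij by (simp add: N_def)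
  have "{A \<in> P. (i \<in> A) = False \<and> (j \<in> A) = True} = {A \<in> P. j \<in> A \<and> i \<notin> A}" by blast
  then have FT: "N False True = ((2 * k - 2) choose (k - 1))"
    using one[of j i] ij by (simp add: N_def insert_commute)
  have TT: "N True True = N False False"
    unfolding N_def
  proof (rule bij_betw_same_card, rule bij_betw_byWitness[where f' = "\<lambda>A. {..<2 * k} - A" and f = "\<lambda>A. {..<2 * k} - A"])
    have "{..<2 * k} - A \<in> P" if "A \<in> P" for A
      using that finite_subset[of A "{..<2 * k}"] by (auto simp: P_def card_Diff_subset)
    then show "(\<lambda>A. {..<2 * k} - A) ` {A \<in> P. (i \<in> A) = True \<and> (j \<in> A) = True}
          \<subseteq> {A \<in> P. (i \<in> A) = False \<and> (j \<in> A) = False}"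
      and "(\<lambda>A. {..<2 * k} - A) ` {A \<in> P. (i \<in> A) = False \<and> (j \<in> A) = False}
          \<subseteq> {A \<in> P. (i \<in> A) = True \<and> (j \<in> A) = True}"
      using ij by auto
  qed (auto simp: P_def)
  have "(\<Sum>A\<in>P. F (i \<in> A) (j \<in> A))
      = (\<Sum>ab\<in>UNIV \<times> UNIV. \<Sum>A\<in>{A \<in> P. (i \<in> A, j \<in> A) = ab}. F (i \<in> A) (j \<in> A))"
    by (rule sum.group[symmetric]) (auto simp: finP)
  also have "\<dots> = (\<Sum>(a, b)\<in>UNIV \<times> UNIV. real (N a b) * F a b)"
    by (intro sum.cong refl) (auto simp: N_def)
  also have "\<dots> = real (N True True) * F True True + real (N True False) * F True False
      + real (N False True) * F False True + real (N False False) * F False False"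
    by (simp add: UNIV_bool flip: sum.cartesian_product)
  finally show ?thesis
    unfolding TT TF FT FF P_def by (simp add: algebra_simps)
qed

text \<open>
  Normalised so that the weights of the four cases are $k$ and $k-1$. They encode that two fixed
  indices are separated by a random balanced set with probability $k/(2k-1)$.
\<close>

lemma balanced_average:
  assumes k: "1 \<le> k"
  obtains c :: real where "0 \<le> c"
    "\<And>i j F. i < 2 * k \<Longrightarrow> j < 2 * k \<Longrightarrow> i \<noteq> j \<Longrightarrow>
       c * (\<Sum>A | A \<subseteq> {..<2 * k} \<and> card A = k. F (i \<in> A) (j \<in> A))
       = real k * (F True False + F False True) + (real k - 1) * (F True True + F False False)"
proof -
  define a b where "a = ((2 * k - 2) choose (k - 1))" and "b = ((2 * k - 2) choose k)"
  obtain m where m: "k = Suc m" using k by (cases k) auto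
  have "a > 0" by (simp add: a_def m)
  \<comment> \<open>marking an element of a \<open>k\<close>-set is marking an element outside a \<open>(k - 1)\<close>-set\<close>
  have "k * b = (2 * m) * ((2 * m - 1) choose m)"
    using binomial_absorption[of m "2 * m"] by (simp add: b_def m)
  also have "\<dots> = m * a"
    using binomial_absorb_comp[of "2 * m" m] by (auto simp: a_def m)
  finally have "real k * real b = real m * real a"
    by (metis of_nat_mult)
  then have kb: "real k * real b = (real k - 1) * real a" by (simp add: m)
  have scale: "real k / real a * (real a * x + real b * y) = real k * x + (real k - 1) * y" for x y
  proof -
    have "real k / real a * (real a * x + real b * y) = real k * x + (real k * real b) * y / real a"
      using \<open>a > 0\<close> by (simp add: field_simps)
    then show ?thesis using \<open>a > 0\<close> by (simp add: kb)
  qed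
  show thesis
  proof (rule that)
    fix i j F assume ij: "i < 2 * k" "j < 2 * k" "i \<noteq> j"
    show "real k / real a * (\<Sum>A | A \<subseteq> {..<2 * k} \<and> card A = k. F (i \<in> A) (j \<in> A))
      = real k * (F True False + F False True) + (real k - 1) * (F True True + F False False)"
      unfolding sum_balanced_subsets[OF k ij] a_def[symmetric] b_def[symmetric] by (rule scale)
  qed simp
qed

section \<open>Metrics with two hubs are close to the cut cone\<close>

lemma circle_dist_small: "\<bar>x - y\<bar> \<le> D \<Longrightarrow> circle_dist D x y = \<bar>x - y\<bar>"
  by (simp add: circle_dist_def)

text \<open>
  The distance from the hub $s$ reached on the circle by the point at position $p$ of a path of
  length $D$: the paths in the random set stay at $s$ during their first half and then move at
  double speed (\<open>arc_A\<close>), the other paths move at double speed until they reach $t$ and then stay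
  there (\<open>arc_B\<close>).
\<close>

definition arc_A :: "real \<Rightarrow> real \<Rightarrow> real" where
  "arc_A D p = max 0 (2 * p - D)"

definition arc_B :: "real \<Rightarrow> real \<Rightarrow> real" where
  "arc_B D p = min (2 * p) D"

lemma arcs_sum: "arc_A D p + arc_B D p = 2 * p"
  by (simp add: arc_A_def arc_B_def)

lemma arc_bounds:
  assumes "0 \<le> p" "p \<le> D"
  shows "0 \<le> arc_A D p" "arc_A D p \<le> D" "0 \<le> arc_B D p" "arc_B D p \<le> D"
  using assms by (auto simp: arc_A_def arc_B_def)

text \<open>
  On opposite sides nothing is lost. If both points lie in the first halves of their paths, one of
  them sits at $s$ and the other is at twice its distance from $s$; exchanging the sides and
  averaging gives $p + r$. If they lie in different halves, one of the two arrangements puts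
  them at $s$ and $t$, at distance $D$, and the other at distance $D - 2|p - (D - r)|$, while the
  true distance is $D - |p - (D - r)|$.
\<close>

lemma opposite_sides_dist:
  assumes "0 \<le> p" "p \<le> D" "0 \<le> r" "r \<le> D"
  shows "2 * min (p + r) (2 * D - p - r)
    \<le> circle_dist D (- arc_A D p) (arc_B D r) + circle_dist D (arc_B D p) (- arc_A D r)"
  using assms unfolding circle_dist_def arc_A_def arc_B_def
  by (auto simp: min_def max_def abs_if)

text \<open>
  On the same side the circle alone can shrink the distance, down to 0 for $p = r$. The legs
  $\min(p, D-p)$ of the star are the distances to the nearer hub and make up for it.
\<close>

lemma same_side_dist:
  assumes "0 \<le> p" "p \<le> D" "0 \<le> r" "r \<le> D"
  shows "2 * min (p + r) (2 * D - p - r)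
    \<le> circle_dist D (- arc_A D p) (- arc_A D r) + circle_dist D (arc_B D p) (arc_B D r)
      + 2 * (min p (D - p) + min r (D - r))"
  using assms unfolding circle_dist_def arc_A_def arc_B_def
  by (auto simp: min_def max_def abs_if)

text \<open>
  The metric $\delta$ is the mixture of random circles and a star. In the average over the balanced
  sets, the pairs on opposite sides have weight $k$ and those on the same side $k-1$, which is also
  the weight of the star. So \<open>opposite_sides_dist\<close> and \<open>same_side_dist\<close> can be added with these
  weights, and the lower bound follows. The upper bound needs to be checked only for pairs with
  a hub: for the others it follows from the triangle inequality for $\delta$, as every distance in
  $X$ is realised over a hub.
\<close>

lemma two_hub_metric_near_cut_cone:
  fixes d :: "'v \<Rightarrow> 'v \<Rightarrow> real" and X :: "'v set" and s t :: 'v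
  defines "V \<equiv> insert s (insert t X)"
  assumes k: "1 \<le> k" and X: "finite X" "card X \<le> 2 * k" and st: "s \<noteq> t" "s \<notin> X" "t \<notin> X"
    and refl: "\<And>u. u \<in> V \<Longrightarrow> d u u = 0"
    and sym: "\<And>u v. u \<in> V \<Longrightarrow> v \<in> V \<Longrightarrow> d u v = d v u"
    and triangle: "\<And>u v x. u \<in> V \<Longrightarrow> v \<in> V \<Longrightarrow> x \<in> V \<Longrightarrow> d u x \<le> d u v + d v x"
    and hubs: "\<And>x y. x \<in> X \<Longrightarrow> y \<in> X \<Longrightarrow> x \<noteq> y \<Longrightarrow> min (d s x + d s y) (d t x + d t y) \<le> d x y"
  obtains \<delta> where "cut_cone V \<delta>" "\<And>u v. u \<in> V \<Longrightarrow> v \<in> V \<Longrightarrow> \<delta> u v \<le> d u v"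
    "\<And>u v. u \<in> V \<Longrightarrow> v \<in> V \<Longrightarrow> (2 * real k - 1) / (3 * real k - 2) * d u v \<le> \<delta> u v"
proof -
  define \<kappa> where "\<kappa> = real k"
  have \<kappa>: "1 \<le> \<kappa>" using k by (simp add: \<kappa>_def)
  define \<alpha> where "\<alpha> = (2 * \<kappa> - 1) / (3 * \<kappa> - 2)"
  define \<beta> where "\<beta> = (\<kappa> - 1) / (3 * \<kappa> - 2)"
  have \<alpha>\<beta>: "\<alpha> + \<beta> = 1" "0 \<le> \<beta>" "0 \<le> \<alpha>"
    using \<kappa> by (auto simp: \<alpha>_def \<beta>_def simp flip: add_divide_distrib)
  define D where "D = d s t"
  have finV: "finite V" and s: "s \<in> V" and t: "t \<in> V" and XV: "\<And>x. x \<in> X \<Longrightarrow> x \<in> V"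
    using X by (auto simp: V_def)
  \<comment> \<open>position on the private path and length of the pendant edge; these solve the two
    equations \<open>d s x = p x + e x\<close> and \<open>d t x = D - p x + e x\<close>\<close>
  define p where "p x = (d s x - d t x + D) / 2" for x
  define e where "e x = (d s x + d t x - D) / 2" for x
  have ds: "d s x = p x + e x" and dt: "d t x = D - p x + e x" for x
    by (auto simp: p_def e_def field_simps)
  have p: "0 \<le> p x" "p x \<le> D" and e: "0 \<le> e x" if "x \<in> X" for x
    using triangle[OF s XV[OF that] t] triangle[OF t s XV[OF that]] triangle[OF s t XV[OF that]]
      sym[OF s t] sym[OF t XV[OF that]]
    by (auto simp: p_def e_def D_def)
  have D: "0 \<le> D" using triangle[OF s t s] refl[OF s] sym[OF s t] by (simp add: D_def)
  obtain h where h: "inj_on h X" "h ` X \<subseteq> {..<2 * k}"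
    using X card_le_inj[of X "{..<2 * k}"] by auto
  \<comment> \<open>the place of \<open>v\<close> on the circle if the path of \<open>v\<close> is in the random set (\<open>a\<close>) or not\<close>
  define q where "q v a = (if v = s then 0 else if v = t then D
      else if a then - arc_A D (p v) else arc_B D (p v))" for v and a :: bool
  have q_le: "\<bar>q v a\<bar> \<le> D" if "v \<in> V" for v a
    using that D p arc_bounds[of "p v" D] by (auto simp: q_def V_def)
  have q_simps: "q s a = 0" "q t a = D" for a using st by (auto simp: q_def)
  have q_X: "q x True = - arc_A D (p x)" "q x False = arc_B D (p x)" if "x \<in> X" for x
    using that st by (auto simp: q_def)
  obtain c where c: "0 \<le> c"
    "\<And>i j F. i < 2 * k \<Longrightarrow> j < 2 * k \<Longrightarrow> i \<noteq> j \<Longrightarrow>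
       c * (\<Sum>A | A \<subseteq> {..<2 * k} \<and> card A = k. F (i \<in> A) (j \<in> A))
       = \<kappa> * (F True False + F False True) + (\<kappa> - 1) * (F True True + F False False)"
    by (rule balanced_average[OF k, folded \<kappa>_def]) (rule that)
  define E where "E u v = c * (\<Sum>A | A \<subseteq> {..<2 * k} \<and> card A = k.
      circle_dist D (q u (h u \<in> A)) (q v (h v \<in> A)))" for u v
  define g where "g v = (if v \<in> X then e v + \<beta> * min (p v) (D - p v) else 0)" for v
  have g_nonneg: "0 \<le> g v" for v using p e \<alpha>\<beta> by (auto simp: g_def)
  define \<delta> where "\<delta> u v = 1 / (2 * (3 * \<kappa> - 2)) * E u v + (if u = v then 0 else g u + g v)" for u v
  have cone: "cut_cone V \<delta>"
    unfolding \<delta>_def E_def using \<kappa> c(1) g_nonneg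
    by (intro cut_cone_add cut_cone_scale cut_cone_sum cut_cone_circle cut_cone_star finV q_le) auto

  have E_hub: "E u x = (2 * \<kappa> - 1) * (circle_dist D z (q x True) + circle_dist D z (q x False))"
    if "x \<in> X" "\<And>a. q u a = z" for u x z
  proof -
    have hx: "h x < 2 * k" using h that by auto
    \<comment> \<open>only one index matters here; any second one lets the average over pairs be used\<close>
    obtain j where j: "j < 2 * k" "h x \<noteq> j"
      by (rule that[of "if h x = 0 then 1 else 0"]) (use k in auto)
    show ?thesis
      unfolding E_def that(2)
      using c(2)[OF hx j, of "\<lambda>a b. circle_dist D z (q x a)"] by (simp add: algebra_simps)
  qed
  have half: "1 / (2 * (3 * \<kappa> - 2)) * ((2 * \<kappa> - 1) * (2 * r)) = \<alpha> * r" for r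
  proof -
    have "2 * (3 * \<kappa> - 2) \<noteq> 0" using \<kappa> by simp
    then show ?thesis by (simp add: \<alpha>_def divide_simps)
  qed
  have \<delta>s: "\<delta> s x = \<alpha> * p x + g x" if "x \<in> X" for x
  proof -
    have "E s x = (2 * \<kappa> - 1) * (2 * p x)"
      using E_hub[OF that q_simps(1)] q_X[OF that] arc_bounds[OF p[OF that]] arcs_sum[of D "p x"]
      by (simp add: circle_dist_small)
    then have "\<delta> s x = \<alpha> * p x + (if s = x then 0 else g s + g x)"
      unfolding \<delta>_def by (simp only: half)
    then show ?thesis using that st by (auto simp: g_def)
  qed
  have \<delta>t: "\<delta> t x = \<alpha> * (D - p x) + g x" if "x \<in> X" for x
  proof -
    have "circle_dist D D (- arc_A D (p x)) = D - arc_A D (p x)"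
      "circle_dist D D (arc_B D (p x)) = D - arc_B D (p x)"
      using arc_bounds[OF p[OF that]] by (auto simp: circle_dist_def)
    then have "E t x = (2 * \<kappa> - 1) * (2 * (D - p x))"
      using E_hub[OF that q_simps(2)] q_X[OF that] arcs_sum[of D "p x"] by simp
    then have "\<delta> t x = \<alpha> * (D - p x) + (if t = x then 0 else g t + g x)"
      unfolding \<delta>_def by (simp only: half)
    then show ?thesis using that st by (auto simp: g_def)
  qed
  have \<delta>st: "\<delta> s t = \<alpha> * D"
  proof -
    have "E s t = (2 * \<kappa> - 1) * (2 * D)"
      unfolding E_def q_simps using c(2)[of 0 1 "\<lambda>a b. circle_dist D 0 D"] k D
      by (simp add: circle_dist_small algebra_simps)
    then have "\<delta> s t = \<alpha> * D + (if s = t then 0 else g s + g t)"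
      unfolding \<delta>_def by (simp only: half)
    then show ?thesis using st by (simp add: g_def)
  qed
  have \<delta>self: "\<delta> u u = 0" for u
    using D by (simp add: \<delta>_def E_def circle_dist_def)
  note \<delta>sym = cut_cone_sym[OF cone]

  have bounds: "\<alpha> * d u v \<le> \<delta> u v \<and> \<delta> u v \<le> d u v"
    if uv: "(u, v) \<in> {s, t} \<times> X \<or> (u, v) = (s, t)" for u v
  proof -
    have low: "\<alpha> * (r + e x) \<le> \<alpha> * r + g x" and up: "\<alpha> * r + g x \<le> r + e x"
      if "x \<in> X" "min (p x) (D - p x) \<le> r" for x r
    proof -
      have "\<alpha> * e x \<le> e x" using \<alpha>\<beta> e[OF that(1)] by (intro mult_left_le_one_le) auto
      moreover have "0 \<le> \<beta> * min (p x) (D - p x)" using \<alpha>\<beta> p[OF that(1)] by simp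
      ultimately show "\<alpha> * (r + e x) \<le> \<alpha> * r + g x" using that by (simp add: g_def distrib_left)
      have "\<beta> * min (p x) (D - p x) \<le> \<beta> * r" using \<alpha>\<beta> that by (intro mult_left_mono)
      moreover have "\<alpha> * r + \<beta> * r = r" using \<alpha>\<beta> by (simp flip: distrib_right)
      ultimately show "\<alpha> * r + g x \<le> r + e x" using that by (simp add: g_def)
    qed
    have "\<alpha> * D \<le> D" using \<alpha>\<beta> D by (intro mult_left_le_one_le) auto
    from uv consider "u = s" "v = t" | "u = s" "v \<in> X" | "u = t" "v \<in> X" by auto
    then show ?thesis
    proof cases
      case 1
      then show ?thesis using \<open>\<alpha> * D \<le> D\<close> by (simp add: \<delta>st flip: D_def)
    next
      case 2
      then show ?thesis
        using low[of v "p v"] up[of v "p v"] by (simp add: \<delta>s ds)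
    next
      case 3
      then show ?thesis
        using low[of v "D - p v"] up[of v "D - p v"] by (simp add: \<delta>t dt)
    qed
  qed
  have boundsX: "\<alpha> * d x y \<le> \<delta> x y \<and> \<delta> x y \<le> d x y"
    if xy: "x \<in> X" "y \<in> X" "x \<noteq> y" for x y
  proof
    have "\<delta> x y \<le> \<delta> s x + \<delta> s y" "\<delta> x y \<le> \<delta> t x + \<delta> t y"
      using cut_cone_triangle[OF cone, of x _ y] \<delta>sym[of x] s t XV xy by fastforce+
    then show "\<delta> x y \<le> d x y"
      using bounds[of s x] bounds[of s y] bounds[of t x] bounds[of t y] hubs[OF xy] xy by auto
    define M where "M = min (p x + p y) (2 * D - p x - p y)"
    have "d x y \<le> M + (e x + e y)"
      using triangle[of x s y] triangle[of x t y] sym[of x] s t XV xy ds[of x] dt[of x] ds[of y] dt[of y]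
      by (fastforce simp: M_def)
    have hxy: "h x < 2 * k" "h y < 2 * k" "h x \<noteq> h y"
      using h xy by (auto dest: inj_onD)
    define opp where "opp = circle_dist D (- arc_A D (p x)) (arc_B D (p y))
        + circle_dist D (arc_B D (p x)) (- arc_A D (p y))"
    define same where "same = circle_dist D (- arc_A D (p x)) (- arc_A D (p y))
        + circle_dist D (arc_B D (p x)) (arc_B D (p y))"
    define m where "m = min (p x) (D - p x) + min (p y) (D - p y)"
    have E: "E x y = \<kappa> * opp + (\<kappa> - 1) * same"
      unfolding E_def opp_def same_def
      using c(2)[OF hxy, of "\<lambda>a b. circle_dist D (q x a) (q y b)"] q_X[OF xy(1)] q_X[OF xy(2)]
      by simp
    have "2 * M \<le> opp" "2 * M \<le> same + 2 * m"
      using opposite_sides_dist[of "p x" D "p y"] same_side_dist[of "p x" D "p y"] p xy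
      by (auto simp: M_def opp_def same_def m_def)
    then have "\<kappa> * (2 * M) + (\<kappa> - 1) * (2 * M) \<le> \<kappa> * opp + (\<kappa> - 1) * (same + 2 * m)"
      using \<kappa> by (intro add_mono mult_left_mono) auto
    then have "(2 * \<kappa> - 1) * (2 * M) \<le> E x y + 2 * (\<kappa> - 1) * m"
      by (simp add: E algebra_simps)
    define H where "H = 2 * (3 * \<kappa> - 2)"
    have H: "0 < H" "\<alpha> * H = 2 * (2 * \<kappa> - 1)" "\<beta> * H = 2 * (\<kappa> - 1)"
    proof -
      have cancel: "a / b * (2 * b) = 2 * a" if "b \<noteq> 0" for a b :: real using that by simp
      have "3 * \<kappa> - 2 \<noteq> 0" using \<kappa> by simp
      then show "\<alpha> * H = 2 * (2 * \<kappa> - 1)" "\<beta> * H = 2 * (\<kappa> - 1)"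
        unfolding H_def \<alpha>_def \<beta>_def by (rule cancel)+
    qed (use \<kappa> in \<open>simp add: H_def\<close>)
    have "(\<alpha> * H) * M \<le> E x y + (\<beta> * H) * m"
      using \<open>(2 * \<kappa> - 1) * (2 * M) \<le> _\<close> unfolding H by (simp add: mult_ac)
    then have "\<alpha> * M \<le> E x y / H + \<beta> * m"
      using H(1) by (simp add: field_simps)
    then have "\<alpha> * M \<le> E x y / (2 * (3 * \<kappa> - 2)) + \<beta> * m"
      by (simp only: H_def)
    moreover have "\<alpha> * (e x + e y) \<le> e x + e y"
      using \<alpha>\<beta> e xy by (intro mult_left_le_one_le) auto
    ultimately have "\<alpha> * (M + (e x + e y)) \<le> \<delta> x y"
      using xy by (simp add: \<delta>_def g_def m_def distrib_left)
    moreover have "\<alpha> * d x y \<le> \<alpha> * (M + (e x + e y))"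
      using \<open>d x y \<le> M + (e x + e y)\<close> \<alpha>\<beta> by (intro mult_left_mono)
    ultimately show "\<alpha> * d x y \<le> \<delta> x y" by simp
  qed
  have all: "\<alpha> * d u v \<le> \<delta> u v \<and> \<delta> u v \<le> d u v" if uv: "u \<in> V" "v \<in> V" for u v
  proof -
    consider "u = v" | "(u, v) \<in> {s, t} \<times> X \<or> (u, v) = (s, t)" | "(v, u) \<in> {s, t} \<times> X \<or> (v, u) = (s, t)"
      | "u \<in> X" "v \<in> X" "u \<noteq> v"
      using uv by (auto simp: V_def)
    then show ?thesis
    proof cases
      case 1
      then show ?thesis using that refl \<delta>self by simp
    next
      case 2
      then show ?thesis by (rule bounds)
    next
      case 3
      then show ?thesis using bounds[OF 3] \<delta>sym[OF that] sym[OF that] by simp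
    next
      case 4
      then show ?thesis by (rule boundsX)
    qed
  qed
  show thesis
    by (rule that[OF cone]) (use all in \<open>auto simp: \<alpha>_def \<kappa>_def\<close>)
qed

section \<open>Bounds for the distortion\<close>

lemma distortion_le:
  fixes L L' :: real
  assumes "\<And>x y. x \<in> X \<Longrightarrow> y \<in> X \<Longrightarrow> 0 \<le> dX x y"
    and "\<And>x y. x \<in> X \<Longrightarrow> y \<in> X \<Longrightarrow> dX x y = 0 \<longleftrightarrow> x = y"
    and "\<And>x y. x \<in> X \<Longrightarrow> y \<in> X \<Longrightarrow> dY (f x) (f y) \<le> dX x y"
    and "\<And>x y. x \<in> X \<Longrightarrow> y \<in> X \<Longrightarrow> dX x y \<le> L * dY (f x) (f y)"
    and "\<And>x y. x \<in> X \<Longrightarrow> y \<in> X \<Longrightarrow> f x = f y \<Longrightarrow> dY (f x) (f y) = 0"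
    and "1 \<le> L"
  shows "distortion X dX dY f \<le> ennreal L"
proof -
  have inj: "inj_on f X"
  proof (rule inj_onI)
    fix x y assume *: "x \<in> X" "y \<in> X" "f x = f y"
    with assms(4)[of x y] assms(5)[of x y] assms(1)[of x y] assms(2)[of x y] show "x = y" by simp
  qed
  have 1: "ennreal (dY (f x) (f y)) / ennreal (dX x y) \<le> 1"
    if "x \<in> X" "y \<in> X" "dX x y \<noteq> 0" for x y
  proof -
    have pos: "0 < dX x y" using that assms(1)[of x y] by simp
    have "ennreal (dY (f x) (f y)) / ennreal (dX x y) \<le> ennreal (dX x y) / ennreal (dX x y)"
      using assms(3) that by (intro divide_right_mono_ennreal ennreal_leI) auto
    also have "\<dots> = 1" using pos by simp
    finally show ?thesis .
  qed
  have 2: "ennreal (dX x y) / ennreal (dY (f x) (f y)) \<le> ennreal L"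
    if "x \<in> X" "y \<in> X" "dX x y \<noteq> 0" for x y
  proof -
    have pos: "0 < dX x y" using that assms(1)[of x y] by simp
    then have "0 < L * dY (f x) (f y)" using assms(4)[of x y] that by linarith
    then have pos': "0 < dY (f x) (f y)" using assms(6) by (simp add: zero_less_mult_iff)
    have "ennreal (dX x y) / ennreal (dY (f x) (f y)) = ennreal (dX x y / dY (f x) (f y))"
      using pos pos' by (simp add: divide_ennreal)
    also have "\<dots> \<le> ennreal L"
      using assms(4)[of x y] that pos' by (intro ennreal_leI) (simp add: field_simps)
    finally show ?thesis .
  qed
  show ?thesis
  proof (cases "is_singleton X")
    case True
    then show ?thesis using assms(6) by (simp add: distortion_def)
  next
    case False
    have "(SUP (x, y) \<in> {(x, y) \<in> X \<times> X. dX x y \<noteq> 0}. ennreal (dY (f x) (f y)) / ennreal (dX x y))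
        * (SUP (x, y) \<in> {(x, y) \<in> X \<times> X. dX x y \<noteq> 0}. ennreal (dX x y) / ennreal (dY (f x) (f y)))
       \<le> 1 * ennreal L"
      by (intro mult_mono SUP_least) (auto intro: 1 2)
    then show ?thesis using False inj by (simp add: distortion_def)
  qed
qed

text \<open>
  A bound for all pairs of Lipschitz constants of $f$ and its inverse is one for the distortion. The
  pair of distinct points is needed to rule out that one supremum is 0 while the other is
  infinite, where their product would be 0.
\<close>

lemma le_distortion:
  fixes c :: real
  assumes "\<not> is_singleton X" and xy: "x0 \<in> X" "y0 \<in> X" "0 < dX x0 y0"
    and pos: "\<And>x y. x \<in> X \<Longrightarrow> y \<in> X \<Longrightarrow> f x \<noteq> f y \<Longrightarrow> 0 < dY (f x) (f y)"
    and X: "\<And>x. x \<in> X \<Longrightarrow> dX x x = 0"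
       "\<And>x y. x \<in> X \<Longrightarrow> y \<in> X \<Longrightarrow> 0 \<le> dX x y"
    and bound: "\<And>L L'. 0 \<le> L \<Longrightarrow> 0 \<le> L' \<Longrightarrow>
      (\<And>x y. x \<in> X \<Longrightarrow> y \<in> X \<Longrightarrow> dX x y \<noteq> 0 \<Longrightarrow> dY (f x) (f y) \<le> L * dX x y) \<Longrightarrow>
      (\<And>x y. x \<in> X \<Longrightarrow> y \<in> X \<Longrightarrow> dX x y \<noteq> 0 \<Longrightarrow> dX x y \<le> L' * dY (f x) (f y)) \<Longrightarrow> c \<le> L * L'"
  shows "ennreal c \<le> distortion X dX dY f"
proof (cases "inj_on f X")
  case False
  then show ?thesis using assms(1) by (simp add: distortion_def)
next
  case inj: True
  define P where "P = {(x, y) \<in> X \<times> X. dX x y \<noteq> 0}"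
  define L where "L = (SUP (x, y) \<in> P. ennreal (dY (f x) (f y)) / ennreal (dX x y))"
  define L' where "L' = (SUP (x, y) \<in> P. ennreal (dX x y) / ennreal (dY (f x) (f y)))"
  have dist: "distortion X dX dY f = L * L'"
    using assms(1) inj by (simp add: distortion_def L_def L'_def P_def)
  have dX: "0 < dX x y" and dY: "0 < dY (f x) (f y)" if "(x, y) \<in> P" for x y
  proof -
    from that have *: "x \<in> X" "y \<in> X" "dX x y \<noteq> 0" by (auto simp: P_def)
    then show "0 < dX x y" using X(2)[of x y] by simp
    from * have "x \<noteq> y" using X(1) by auto
    then show "0 < dY (f x) (f y)" using * inj pos by (auto dest: inj_onD)
  qed
  have ratio: "ennreal (dY (f x) (f y) / dX x y) \<le> L"
    and ratio': "ennreal (dX x y / dY (f x) (f y)) \<le> L'" if "(x, y) \<in> P" for x y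
  proof -
    show "ennreal (dY (f x) (f y) / dX x y) \<le> L"
      unfolding L_def using that dX[OF that] dY[OF that]
      by (intro SUP_upper2[OF that]) (simp add: divide_ennreal)
    show "ennreal (dX x y / dY (f x) (f y)) \<le> L'"
      unfolding L'_def using that dX[OF that] dY[OF that]
      by (intro SUP_upper2[OF that]) (simp add: divide_ennreal)
  qed
  have P0: "(x0, y0) \<in> P" using xy by (auto simp: P_def)
  have "0 < ennreal (dY (f x0) (f y0) / dX x0 y0)" "0 < ennreal (dX x0 y0 / dY (f x0) (f y0))"
    using dX[OF P0] dY[OF P0] by auto
  then have nz: "L \<noteq> 0" "L' \<noteq> 0" using ratio[OF P0] ratio'[OF P0] by auto
  show ?thesis
  proof (cases "L = top \<or> L' = top")
    case True
    then have "L * L' = top" using nz by (auto simp: ennreal_top_mult ennreal_mult_top)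
    then show ?thesis using dist by simp
  next
    case False
    then obtain l l' where l: "L = ennreal l" "0 \<le> l" and l': "L' = ennreal l'" "0 \<le> l'"
      by (metis ennreal_cases)
    have "c \<le> l * l'"
    proof (rule bound)
      fix x y assume "x \<in> X" "y \<in> X" "dX x y \<noteq> 0"
      then have xy: "(x, y) \<in> P" by (auto simp: P_def)
      show "dY (f x) (f y) \<le> l * dX x y" "dX x y \<le> l' * dY (f x) (f y)"
        using ratio[OF xy] ratio'[OF xy] l l' dX[OF xy] dY[OF xy]
        by (auto simp: ennreal_le_iff field_simps)
    qed (use l l' in auto)
    then show ?thesis using l l' dist by (simp add: ennreal_leI flip: ennreal_mult)
  qed
qed

section \<open>The shortest path metric\<close>

lemma image_Times_const:
  assumes "a \<in> A" "b \<in> B" "\<And>x y. x \<in> A \<Longrightarrow> y \<in> B \<Longrightarrow> f x y = c"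
  shows "(\<lambda>(x, y). f x y) ` (A \<times> B) = {c}"
  using assms by (auto simp: image_iff)

locale connected_weighted_graph = graph G
  for G :: "('a, 'b) pre_digraph" (structure) +
  fixes w :: "'a set \<Rightarrow> real"
  assumes strongly_connected: "strongly_connected G"
    and weight_nonneg: "\<And>e. e \<in> edges G \<Longrightarrow> 0 \<le> w e"
begin

lemma arc_weight_nonneg: "a \<in> arcs G \<Longrightarrow> 0 \<le> w {tail G a, head G a}"
  by (rule weight_nonneg) (auto simp: edges_def arcs_ends_def arc_to_ends_def)

lemma path_weight_nonneg: "awalk u p v \<Longrightarrow> 0 \<le> path_weight G w p"
  unfolding path_weight_def
  by (rule sum_list_nonneg) (auto simp: arc_weight_nonneg awalk_def)

lemma finite_path_weights: "finite {path_weight G w p | p. apath u p v}"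
  using finite_imageI[OF apaths_finite, of "path_weight G w" u v]
  by (simp add: setcompr_eq_image)

text \<open>
  The minimum runs over simple paths, but for nonnegative weights removing cycles from a walk does
  not increase its weight. Therefore concatenations need not be simple in the triangle inequality.
\<close>

lemma sp_dist_le_path_weight:
  assumes "awalk u p v"
  shows "sp_dist G w u v \<le> path_weight G w p"
proof -
  define c where "c = (\<lambda>a. w {tail G a, head G a})"
  have cost: "awalk_cost c q = path_weight G w q" for q
    by (simp add: awalk_cost_def path_weight_def c_def)
  have "awalk_cost c (awalk_to_apath p) \<le> awalk_cost c p"
    by (rule awalk_to_path_no_neg_cyc_cost[OF assms])
      (auto simp: cost not_less intro: path_weight_nonneg)
  moreover have "apath u (awalk_to_apath p) v"
    by (rule apath_awalk_to_apath[OF assms])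
  then have "sp_dist G w u v \<le> path_weight G w (awalk_to_apath p)"
    unfolding sp_dist_def by (intro Min_le finite_path_weights) auto
  ultimately show ?thesis by (simp add: cost)
qed

lemma sp_dist_attained:
  assumes "u \<in> verts G" "v \<in> verts G"
  obtains p where "awalk u p v" "path_weight G w p = sp_dist G w u v"
proof -
  have "u \<rightarrow>\<^sup>* v"
    using strongly_connected assms by (auto simp: strongly_connected_def)
  then obtain p where "apath u p v"
    by (auto simp: reachable_apath)
  then have "{path_weight G w p | p. apath u p v} \<noteq> {}" by blast
  from Min_in[OF finite_path_weights this] obtain q
    where "apath u q v" "path_weight G w q = sp_dist G w u v"
    unfolding sp_dist_def by auto
  then show thesis using that by (auto simp: apath_def)
qed

lemma sp_dist_nonneg: "u \<in> verts G \<Longrightarrow> v \<in> verts G \<Longrightarrow> 0 \<le> sp_dist G w u v"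
  by (metis sp_dist_attained path_weight_nonneg)

lemma sp_dist_self: "u \<in> verts G \<Longrightarrow> sp_dist G w u u = 0"
  using sp_dist_le_path_weight[of u "[]" u] sp_dist_nonneg[of u u]
  by (auto simp: awalk_Nil_iff path_weight_def)

lemma sp_dist_triangle:
  assumes "u \<in> verts G" "v \<in> verts G" "x \<in> verts G"
  shows "sp_dist G w u x \<le> sp_dist G w u v + sp_dist G w v x"
proof -
  obtain p q where "awalk u p v" "path_weight G w p = sp_dist G w u v"
      "awalk v q x" "path_weight G w q = sp_dist G w v x"
    using assms sp_dist_attained by metis
  then show ?thesis
    using sp_dist_le_path_weight[of u "p @ q" x]
    by (auto simp: path_weight_def intro: awalk_appendI)
qed

lemma sp_dist_le_edge:
  assumes "(u, v) \<in> arcs_ends G"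
  shows "sp_dist G w u v \<le> w {u, v}"
proof -
  from assms obtain a where a: "a \<in> arcs G" "tail G a = u" "head G a = v"
    by (auto simp: arcs_ends_def arc_to_ends_def)
  then have "awalk u [a] v" by (auto simp: awalk_def)
  from sp_dist_le_path_weight[OF this] a show ?thesis by (simp add: path_weight_def)
qed

lemma reverse_walk:
  assumes "awalk u p v"
  shows "\<exists>q. awalk v q u \<and> path_weight G w q = path_weight G w p"
  using assms
proof (induction p arbitrary: u)
  case Nil
  then show ?case by (auto simp: awalk_Nil_iff intro!: exI[of _ "[]"])
next
  case (Cons a p)
  then have a: "a \<in> arcs G" "tail G a = u" and p: "awalk (head G a) p v"
    by (auto simp: awalk_Cons_iff)
  from Cons.IH[OF p] obtain q
    where q: "awalk v q (head G a)" "path_weight G w q = path_weight G w p" by blast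
  have "(head G a, u) \<in> arcs_ends G"
    using a sym_arcs by (auto simp: symmetric_def arcs_ends_def arc_to_ends_def dest: symD)
  then obtain a' where a': "a' \<in> arcs G" "tail G a' = head G a" "head G a' = u"
    by (auto simp: arcs_ends_def arc_to_ends_def)
  have "awalk (head G a) [a'] u" using a' a by (auto simp: awalk_def)
  with q have "awalk v (q @ [a']) u" by (blast intro: awalk_appendI)
  moreover have "path_weight G w (q @ [a']) = path_weight G w (a # p)"
    using q a a' by (simp add: path_weight_def insert_commute)
  ultimately show ?case by blast
qed

lemma sp_dist_sym:
  assumes "u \<in> verts G" "v \<in> verts G"
  shows "sp_dist G w u v = sp_dist G w v u"
proof -
  have "sp_dist G w y x \<le> sp_dist G w x y" if "x \<in> verts G" "y \<in> verts G" for x y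
    using that by (metis sp_dist_attained reverse_walk sp_dist_le_path_weight)
  then show ?thesis using assms by (meson antisym)
qed

lemma sp_dist_via_neighbour:
  assumes "u \<in> verts G" "v \<in> verts G" "u \<noteq> v"
  obtains y where "(u, y) \<in> arcs_ends G" "w {u, y} + sp_dist G w y v \<le> sp_dist G w u v"
proof -
  obtain p where p: "awalk u p v" "path_weight G w p = sp_dist G w u v"
    using sp_dist_attained assms by blast
  with assms(3) obtain a q where aq: "p = a # q" by (cases p) (auto simp: awalk_Nil_iff)
  with p have a: "a \<in> arcs G" "tail G a = u" "awalk (head G a) q v"
    by (auto simp: awalk_Cons_iff)
  have "(u, head G a) \<in> arcs_ends G"
    using a by (auto simp: arcs_ends_def arc_to_ends_def)
  moreover have "w {u, head G a} + sp_dist G w (head G a) v \<le> sp_dist G w u v"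
    using sp_dist_le_path_weight[OF a(3)] p(2) a(2) by (simp add: aq path_weight_def)
  ultimately show thesis using that by blast
qed

abbreviation zero_dist :: "('a \<times> 'a) set" where
  "zero_dist \<equiv> {(u, v) \<in> verts G \<times> verts G. sp_dist G w u v = 0}"

lemma equiv_zero_dist: "equiv (verts G) zero_dist"
proof (rule equivI)
  show "refl_on (verts G) zero_dist" by (auto simp: refl_on_def sp_dist_self)
  show "sym zero_dist" by (auto simp: sym_def sp_dist_sym)
  show "trans zero_dist"
  proof (rule transI, clarsimp)
    fix x y z assume *: "x \<in> verts G" "y \<in> verts G" "z \<in> verts G"
      "sp_dist G w x y = 0" "sp_dist G w y z = 0"
    with sp_dist_triangle[of x y z] sp_dist_nonneg[of x z] show "sp_dist G w x z = 0" by simp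
  qed
qed auto

lemma zero_dist_class_in_points: "u \<in> verts G \<Longrightarrow> zero_dist `` {u} \<in> sp_points G w"
  unfolding sp_points_def by (rule quotientI)

lemma sp_points_cases:
  assumes "A \<in> sp_points G w"
  obtains u where "u \<in> verts G" "A = zero_dist `` {u}"
  using assms unfolding sp_points_def by (elim quotientE)

lemma sp_quot_dist_classes:
  assumes u: "u \<in> verts G" and v: "v \<in> verts G"
  shows "sp_quot_dist G w (zero_dist `` {u}) (zero_dist `` {v}) = sp_dist G w u v"
proof -
  have const: "sp_dist G w u' v' = sp_dist G w u v"
    if "u' \<in> zero_dist `` {u}" "v' \<in> zero_dist `` {v}" for u' v'
  proof -
    from that have verts: "u' \<in> verts G" "v' \<in> verts G"
      and zero: "sp_dist G w u u' = 0" "sp_dist G w v v' = 0" by auto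
    have "sp_dist G w u' u = 0" "sp_dist G w v' v = 0" using zero sp_dist_sym verts u v by auto
    then show ?thesis
      using zero sp_dist_triangle[of u' u v'] sp_dist_triangle[of u v v']
        sp_dist_triangle[of u u' v] sp_dist_triangle[of u' v' v] verts u v by linarith
  qed
  have "u \<in> zero_dist `` {u}" "v \<in> zero_dist `` {v}"
    using u v by (auto simp: sp_dist_self)
  then have "(\<lambda>(x, y). sp_dist G w x y) ` ((zero_dist `` {u}) \<times> (zero_dist `` {v})) = {sp_dist G w u v}"
    by (rule image_Times_const[OF _ _ const])
  then show ?thesis unfolding sp_quot_dist_def by (metis the_elem_eq)
qed

lemma zero_dist_class_eq_iff:
  assumes "u \<in> verts G" "v \<in> verts G"
  shows "zero_dist `` {u} = zero_dist `` {v} \<longleftrightarrow> sp_dist G w u v = 0"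
  using eq_equiv_class_iff[OF equiv_zero_dist assms] assms by auto

end

context connected_weighted_graph
begin

text \<open>
  Embeddings of the quotient may be given on the vertices: they are evaluated at
  representatives of the classes.
\<close>

lemma c1_weighted_le:
  fixes L :: real
  assumes "1 \<le> L" and \<phi>: "\<And>v. v \<in> verts G \<Longrightarrow> \<phi> v \<in> ell1"
    "\<And>u v. u \<in> verts G \<Longrightarrow> v \<in> verts G \<Longrightarrow> ell1_dist (\<phi> u) (\<phi> v) \<le> sp_dist G w u v"
    "\<And>u v. u \<in> verts G \<Longrightarrow> v \<in> verts G \<Longrightarrow> sp_dist G w u v \<le> L * ell1_dist (\<phi> u) (\<phi> v)"
  shows "c1_weighted G w \<le> ennreal L"
proof -
  define rep where "rep A = (SOME u. u \<in> verts G \<and> A = zero_dist `` {u})" for A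
  have rep: "rep A \<in> verts G" "zero_dist `` {rep A} = A" if "A \<in> sp_points G w" for A
  proof -
    from that have "\<exists>u. u \<in> verts G \<and> A = zero_dist `` {u}" by (elim sp_points_cases) blast
    from someI_ex[OF this] show "rep A \<in> verts G" "zero_dist `` {rep A} = A"
      unfolding rep_def by auto
  qed
  have d: "sp_quot_dist G w A B = sp_dist G w (rep A) (rep B)"
    if "A \<in> sp_points G w" "B \<in> sp_points G w" for A B
    using sp_quot_dist_classes[OF rep(1)[OF that(1)] rep(1)[OF that(2)]]
    by (simp only: rep(2)[OF that(1)] rep(2)[OF that(2)])
  have "distortion (sp_points G w) (sp_quot_dist G w) ell1_dist (\<lambda>A. \<phi> (rep A)) \<le> ennreal L"
  proof (rule distortion_le)
    fix A B assume A: "A \<in> sp_points G w" and B: "B \<in> sp_points G w"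
    note verts = rep(1)[OF A] rep(1)[OF B]
    show "0 \<le> sp_quot_dist G w A B" using sp_dist_nonneg[OF verts] d[OF A B] by simp
    show "sp_quot_dist G w A B = 0 \<longleftrightarrow> A = B"
      using zero_dist_class_eq_iff[OF verts] by (simp only: rep(2)[OF A] rep(2)[OF B] d[OF A B])
    show "ell1_dist (\<phi> (rep A)) (\<phi> (rep B)) \<le> sp_quot_dist G w A B"
      "sp_quot_dist G w A B \<le> L * ell1_dist (\<phi> (rep A)) (\<phi> (rep B))"
      using \<phi>(2,3)[OF verts] d[OF A B] by simp_all
    show "ell1_dist (\<phi> (rep A)) (\<phi> (rep B)) = 0" if "\<phi> (rep A) = \<phi> (rep B)"
      using that by (simp add: ell1_dist_def)
  qed fact
  moreover have "(\<lambda>A. \<phi> (rep A)) \<in> sp_points G w \<rightarrow> ell1" using rep \<phi> by auto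
  ultimately show ?thesis
    unfolding c1_weighted_def by (rule INF_lower2[rotated])
qed

text \<open>
  Conversely, a map on the quotient is pulled back to the vertices. For two vertices in the same
  class both Lipschitz conditions hold trivially, so they may be assumed for all pairs.
\<close>

lemma le_c1_weighted:
  fixes c :: real
  assumes uv: "u0 \<in> verts G" "v0 \<in> verts G" "0 < sp_dist G w u0 v0"
    and bound: "\<And>L L' \<phi>. 0 \<le> L \<Longrightarrow> 0 \<le> L' \<Longrightarrow> (\<And>v. v \<in> verts G \<Longrightarrow> \<phi> v \<in> ell1) \<Longrightarrow>
      (\<And>u v. u \<in> verts G \<Longrightarrow> v \<in> verts G \<Longrightarrow> ell1_dist (\<phi> u) (\<phi> v) \<le> L * sp_dist G w u v) \<Longrightarrow>
      (\<And>u v. u \<in> verts G \<Longrightarrow> v \<in> verts G \<Longrightarrow> sp_dist G w u v \<le> L' * ell1_dist (\<phi> u) (\<phi> v)) \<Longrightarrow>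
      c \<le> L * L'"
  shows "ennreal c \<le> c1_weighted G w"
  unfolding c1_weighted_def
proof (rule INF_greatest)
  fix f assume f: "f \<in> sp_points G w \<rightarrow> ell1"
  define cl where "cl u = zero_dist `` {u}" for u
  have cl: "cl u \<in> sp_points G w" if "u \<in> verts G" for u
    using that unfolding cl_def by (rule zero_dist_class_in_points)
  have d: "sp_quot_dist G w (cl u) (cl v) = sp_dist G w u v"
    and eq: "cl u = cl v \<longleftrightarrow> sp_dist G w u v = 0"
    if "u \<in> verts G" "v \<in> verts G" for u v
    using sp_quot_dist_classes[OF that] zero_dist_class_eq_iff[OF that] by (simp_all only: cl_def)
  have cases: thesis if "A \<in> sp_points G w" "\<And>u. u \<in> verts G \<Longrightarrow> A = cl u \<Longrightarrow> thesis" for A thesis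
    using that unfolding cl_def by (elim sp_points_cases)
  show "ennreal c \<le> distortion (sp_points G w) (sp_quot_dist G w) ell1_dist f"
  proof (rule le_distortion)
    show "cl u0 \<in> sp_points G w" "cl v0 \<in> sp_points G w" using cl uv by auto
    show "0 < sp_quot_dist G w (cl u0) (cl v0)" using d uv by simp
    have "cl u0 \<noteq> cl v0" using eq uv by simp
    then show "\<not> is_singleton (sp_points G w)"
      using cl[OF uv(1)] cl[OF uv(2)] by (auto simp: is_singleton_def simp del: Image_singleton_iff)
    show "0 < ell1_dist (f A) (f B)" if "A \<in> sp_points G w" "B \<in> sp_points G w" "f A \<noteq> f B" for A B
      using that f by (intro ell1_dist_pos) auto
    show "sp_quot_dist G w A A = 0" if "A \<in> sp_points G w" for A
      using that by (rule cases) (simp add: d sp_dist_self)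
    show "0 \<le> sp_quot_dist G w A B" if "A \<in> sp_points G w" "B \<in> sp_points G w" for A B
      using that(1) by (rule cases, use that(2) in \<open>rule cases\<close>) (simp add: d sp_dist_nonneg)
    fix L L' :: real
    assume L: "0 \<le> L" "0 \<le> L'"
      and lip: "\<And>A B. A \<in> sp_points G w \<Longrightarrow> B \<in> sp_points G w \<Longrightarrow> sp_quot_dist G w A B \<noteq> 0 \<Longrightarrow>
        ell1_dist (f A) (f B) \<le> L * sp_quot_dist G w A B"
      and colip: "\<And>A B. A \<in> sp_points G w \<Longrightarrow> B \<in> sp_points G w \<Longrightarrow> sp_quot_dist G w A B \<noteq> 0 \<Longrightarrow>
        sp_quot_dist G w A B \<le> L' * ell1_dist (f A) (f B)"
    have self: "ell1_dist x x = 0" for x by (simp add: ell1_dist_def)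
    show "c \<le> L * L'"
    proof (rule bound[OF L, of "\<lambda>v. f (cl v)"])
      show "f (cl v) \<in> ell1" if "v \<in> verts G" for v using f cl[OF that] by auto
      fix u v assume uv: "u \<in> verts G" "v \<in> verts G"
      show "ell1_dist (f (cl u)) (f (cl v)) \<le> L * sp_dist G w u v"
        using lip[OF cl[OF uv(1)] cl[OF uv(2)]] d[OF uv] eq[OF uv] self
        by (cases "sp_dist G w u v = 0") auto
      show "sp_dist G w u v \<le> L' * ell1_dist (f (cl u)) (f (cl v))"
        using colip[OF cl[OF uv(1)] cl[OF uv(2)]] d[OF uv] eq[OF uv] self
        by (cases "sp_dist G w u v = 0") auto
    qed
  qed
qed

end

section \<open>Weighted complete bipartite graphs with two hubs\<close>

text \<open>
  With $r = k-1$, the coefficients $1$ on $W$ and $-r$ on the hubs have sum 1. In the resulting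
  inequality the pairs inside $W$ and the pair of hubs contribute at least
  $4r(2r+1) + 4r^2 = 4r(3r+1)$, after scaling by $L'$, and the pairs of a hub and an element of $W$
  at most $4r(2r+1)L$. For $k = 1$ the factor $4r$ vanishes and nothing is obtained.
\<close>

lemma hypermetric_distortion_bound:
  fixes \<delta> :: "'v \<Rightarrow> 'v \<Rightarrow> real"
  assumes k: "2 \<le> k" and W: "finite W" "card W = 2 * k - 1" and st: "s \<noteq> t" "s \<notin> W" "t \<notin> W"
    and self: "\<And>u. \<delta> u u = 0" and sym: "\<And>u v. \<delta> u v = \<delta> v u"
    and hyper: "\<And>b :: 'v \<Rightarrow> int. (\<Sum>v\<in>insert s (insert t W). b v) = 1 \<Longrightarrow>
       (\<Sum>u\<in>insert s (insert t W). \<Sum>v\<in>insert s (insert t W). real_of_int (b u * b v) * \<delta> u v) \<le> 0"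
    and near: "\<And>x. x \<in> W \<Longrightarrow> \<delta> s x \<le> L" "\<And>x. x \<in> W \<Longrightarrow> \<delta> t x \<le> L"
    and far: "2 \<le> L' * \<delta> s t" "\<And>x y. x \<in> W \<Longrightarrow> y \<in> W \<Longrightarrow> x \<noteq> y \<Longrightarrow> 2 \<le> L' * \<delta> x y"
    and L': "0 \<le> L'"
  shows "(3 * real k - 2) / (2 * real k - 1) \<le> L * L'"
proof -
  define r where "r = real k - 1"
  have r: "0 < r" and cW: "real (card W) = 2 * r + 1" using k W by (auto simp: r_def)
  define b where "b v = (if v \<in> W then 1 else 1 - int k)" for v
  have b: "b s = 1 - int k" "b t = 1 - int k" "\<And>x. x \<in> W \<Longrightarrow> b x = 1"
    using st by (auto simp: b_def)
  have rb: "real_of_int (1 - int k) = - r" by (simp add: r_def)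
  have "(\<Sum>v\<in>insert s (insert t W). b v) = 1"
    using W st k b by (simp add: of_nat_diff)
  note hyper_b = hyper[OF this]
  have inner: "(\<Sum>v\<in>insert s (insert t W). real_of_int (b u * b v) * \<delta> u v)
      = real_of_int (b u) * ((\<Sum>y\<in>W. \<delta> u y) - r * \<delta> u s - r * \<delta> u t)" for u
  proof -
    have "(\<Sum>v\<in>insert s (insert t W). real_of_int (b u * b v) * \<delta> u v)
        = real_of_int (b u) * (\<Sum>v\<in>insert s (insert t W). real_of_int (b v) * \<delta> u v)"
      by (simp only: sum_distrib_left of_int_mult mult.assoc)
    also have "(\<Sum>v\<in>insert s (insert t W). real_of_int (b v) * \<delta> u v)
        = (\<Sum>y\<in>W. \<delta> u y) - r * \<delta> u s - r * \<delta> u t"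
      using W st by (simp add: b(3)) (simp only: b rb)
    finally show ?thesis .
  qed
  have "(\<Sum>x\<in>W. \<delta> x s) = (\<Sum>x\<in>W. \<delta> s x)" "(\<Sum>x\<in>W. \<delta> x t) = (\<Sum>x\<in>W. \<delta> t x)"
    by (intro sum.cong refl sym)+
  then have "(\<Sum>u\<in>insert s (insert t W). real_of_int (b u) * ((\<Sum>y\<in>W. \<delta> u y) - r * \<delta> u s - r * \<delta> u t))
      = - r * ((\<Sum>y\<in>W. \<delta> s y) - r * \<delta> s t) + (- r * ((\<Sum>y\<in>W. \<delta> t y) - r * \<delta> s t)
        + ((\<Sum>x\<in>W. \<Sum>y\<in>W. \<delta> x y) - r * (\<Sum>y\<in>W. \<delta> s y) - r * (\<Sum>y\<in>W. \<delta> t y)))"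
    using W st by (simp add: b(3) sum_subtractf self flip: sum_distrib_left) (simp only: b rb sym[of t s])
  then have "2 * r\<^sup>2 * \<delta> s t - 2 * r * ((\<Sum>x\<in>W. \<delta> s x) + (\<Sum>x\<in>W. \<delta> t x)) + (\<Sum>x\<in>W. \<Sum>y\<in>W. \<delta> x y) \<le> 0"
    using hyper_b unfolding inner by (simp add: algebra_simps power2_eq_square)
  then have "L' * (2 * r\<^sup>2 * \<delta> s t + (\<Sum>x\<in>W. \<Sum>y\<in>W. \<delta> x y))
      \<le> L' * (2 * r * ((\<Sum>x\<in>W. \<delta> s x) + (\<Sum>x\<in>W. \<delta> t x)))"
    using L' by (intro mult_left_mono) auto
  also have "\<dots> \<le> L' * (2 * r * ((2 * r + 1) * L + (2 * r + 1) * L))"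
    using L' r sum_bounded_above[of W "\<delta> s" L] sum_bounded_above[of W "\<delta> t" L] near cW
    by (intro mult_left_mono add_mono) auto
  finally have upper: "2 * r\<^sup>2 * (L' * \<delta> s t) + L' * (\<Sum>x\<in>W. \<Sum>y\<in>W. \<delta> x y)
      \<le> 4 * r * (2 * r + 1) * (L * L')"
    by (simp add: algebra_simps)
  have "(2 * r + 1) * (2 * r * 2) \<le> L' * (\<Sum>x\<in>W. \<Sum>y\<in>W. \<delta> x y)"
  proof -
    have "2 * r * 2 \<le> L' * (\<Sum>y\<in>W. \<delta> x y)" if x: "x \<in> W" for x
    proof -
      have "real (card (W - {x})) * 2 \<le> (\<Sum>y\<in>W - {x}. L' * \<delta> x y)"
        using far(2) x by (intro sum_bounded_below) auto
      moreover have "real (card (W - {x})) = 2 * r"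
        using W x k by (simp add: r_def)
      moreover have "(\<Sum>y\<in>W. \<delta> x y) = (\<Sum>y\<in>W - {x}. \<delta> x y)"
        using W x self by (simp add: sum.remove[of W x])
      ultimately show ?thesis by (simp add: sum_distrib_left)
    qed
    then have "real (card W) * (2 * r * 2) \<le> (\<Sum>x\<in>W. L' * (\<Sum>y\<in>W. \<delta> x y))"
      by (intro sum_bounded_below)
    then show ?thesis by (simp add: cW sum_distrib_left)
  qed
  moreover have "2 * r\<^sup>2 * 2 \<le> 2 * r\<^sup>2 * (L' * \<delta> s t)" using far(1) by (intro mult_left_mono) auto
  ultimately have "2 * r\<^sup>2 * 2 + (2 * r + 1) * (2 * r * 2) \<le> 4 * r * (2 * r + 1) * (L * L')"
    using upper by linarith
  then have "4 * r * (3 * r + 1) \<le> 4 * r * ((2 * r + 1) * (L * L'))"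
    by (simp add: algebra_simps power2_eq_square)
  then have "3 * r + 1 \<le> (2 * r + 1) * (L * L')" using r by simp
  then show ?thesis using r by (simp add: r_def field_simps)
qed

lemma bipartite_strongly_connected:
  assumes "graph G" and "verts G = {s, t} \<union> X" "X \<noteq> {}"
    and arcs: "arcs_ends G = {s, t} \<times> X \<union> X \<times> {s, t}"
  shows "strongly_connected G"
proof -
  interpret graph G by fact
  from assms obtain x0 where x0: "x0 \<in> X" by blast
  have adj: "u \<rightarrow>\<^sup>*\<^bsub>G\<^esub> v" if "u \<rightarrow>\<^bsub>G\<^esub> v" for u v using that by blast
  have to: "u \<rightarrow>\<^sup>*\<^bsub>G\<^esub> x0" if "u \<in> verts G" for u
  proof (cases "u \<in> X")
    case True
    then have "u \<rightarrow>\<^sup>*\<^bsub>G\<^esub> s" "s \<rightarrow>\<^sup>*\<^bsub>G\<^esub> x0" using x0 by (auto intro!: adj simp: arcs)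
    then show ?thesis by (rule reachable_trans)
  next
    case False
    then show ?thesis using that assms x0 by (intro adj) (auto simp: arcs)
  qed
  have "v \<in> verts G \<Longrightarrow> x0 \<rightarrow>\<^sup>*\<^bsub>G\<^esub> v" for v
    using to symmetric_reachable[OF sym_arcs] by blast
  with to have "\<And>u v. u \<in> verts G \<Longrightarrow> v \<in> verts G \<Longrightarrow> u \<rightarrow>\<^sup>*\<^bsub>G\<^esub> v"
    by (blast intro: reachable_trans)
  then show ?thesis using assms by (auto simp: strongly_connected_def)
qed

locale weighted_K2n = connected_weighted_graph G w
  for G :: "('a, 'b) pre_digraph" (structure) and w :: "'a set \<Rightarrow> real" +
  fixes s t :: 'a and X :: "'a set"
  assumes verts_eq: "verts G = insert s (insert t X)"
    and hubs_distinct: "s \<noteq> t" "s \<notin> X" "t \<notin> X"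
    and arcs_eq: "arcs_ends G = {s, t} \<times> X \<union> X \<times> {s, t}"
begin

lemma finite_X: "finite X"
  using finite_verts verts_eq by simp

text \<open>
  A path between two vertices of $X$ starts with an edge to a hub.
\<close>

lemma sp_dist_via_hub:
  assumes "x \<in> X" "y \<in> X" "x \<noteq> y"
  shows "min (sp_dist G w s x + sp_dist G w s y) (sp_dist G w t x + sp_dist G w t y) \<le> sp_dist G w x y"
proof -
  obtain z where z: "(x, z) \<in> arcs_ends G" "w {x, z} + sp_dist G w z y \<le> sp_dist G w x y"
    using sp_dist_via_neighbour[of x y] assms verts_eq by blast
  have hub: "z = s \<or> z = t" using z(1) assms hubs_distinct arcs_eq by auto
  then have "sp_dist G w z x \<le> w {x, z}"
    using sp_dist_le_edge[OF z(1)] sp_dist_sym[of x z] assms verts_eq by auto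
  with z(2) hub show ?thesis by auto
qed

lemma c1_weighted_K2n_le:
  assumes "card X \<le> 2 * k" "1 \<le> k"
  shows "c1_weighted G w \<le> ennreal ((3 * real k - 2) / (2 * real k - 1))"
proof -
  define \<alpha> where "\<alpha> = (2 * real k - 1) / (3 * real k - 2)"
  have \<alpha>: "0 < \<alpha>" "\<alpha> \<le> 1" using assms by (auto simp: \<alpha>_def)
  obtain \<delta> where cone: "cut_cone (verts G) \<delta>"
    and \<delta>: "\<And>u v. u \<in> verts G \<Longrightarrow> v \<in> verts G \<Longrightarrow> \<delta> u v \<le> sp_dist G w u v"
      "\<And>u v. u \<in> verts G \<Longrightarrow> v \<in> verts G \<Longrightarrow> \<alpha> * sp_dist G w u v \<le> \<delta> u v"
    unfolding \<alpha>_def verts_eq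
  proof (rule two_hub_metric_near_cut_cone[OF assms(2) finite_X assms(1) hubs_distinct, of "sp_dist G w"])
  qed (auto intro!: sp_dist_self sp_dist_sym sp_dist_triangle sp_dist_via_hub simp: verts_eq)
  obtain \<phi> where \<phi>: "\<And>v. \<phi> v \<in> ell1"
    "\<And>u v. u \<in> verts G \<Longrightarrow> v \<in> verts G \<Longrightarrow> ell1_dist (\<phi> u) (\<phi> v) = \<delta> u v"
    using cut_cone_embeds_ell1[OF finite_verts cone] by metis
  have "c1_weighted G w \<le> ennreal (1 / \<alpha>)"
    by (rule c1_weighted_le[of _ \<phi>])
      (use \<alpha> \<phi> \<delta> in \<open>auto simp: field_simps\<close>)
  then show ?thesis by (simp add: \<alpha>_def)
qed

end

text \<open>
  Distinct nonadjacent vertices are at distance at least 2 for unit weights, so the hypermetric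
  bound applies to any $2k-1$ vertices of $X$ and the two hubs. For $k = 1$ the claim is only that a
  distortion is at least 1, which one pair of points shows.
\<close>

lemma le_c1_weighted_unit_K2n:
  assumes K: "weighted_K2n G (\<lambda>_. 1) s t X" and k: "1 \<le> k" "2 * k - 1 \<le> card X"
  shows "ennreal ((3 * real k - 2) / (2 * real k - 1)) \<le> c1_weighted G (\<lambda>_. 1)"
proof -
  interpret weighted_K2n G "\<lambda>_. 1" s t X by fact
  let ?d = "sp_dist G (\<lambda>_. 1)"
  have ge1: "1 \<le> ?d u v" if uv: "u \<in> verts G" "v \<in> verts G" "u \<noteq> v" for u v
  proof -
    obtain y where "(u, y) \<in> arcs_ends G" "1 + ?d y v \<le> ?d u v"
      using sp_dist_via_neighbour[OF uv] by blast
    moreover from this have "0 \<le> ?d y v"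
      using that arcs_eq verts_eq by (intro sp_dist_nonneg) auto
    ultimately show ?thesis by simp
  qed
  have ge2: "2 \<le> ?d u v" if uv: "u \<in> verts G" "v \<in> verts G" "u \<noteq> v" "(u, v) \<notin> arcs_ends G" for u v
  proof -
    obtain y where y: "(u, y) \<in> arcs_ends G" "1 + ?d y v \<le> ?d u v"
      using sp_dist_via_neighbour[OF uv(1-3)] by blast
    have "1 \<le> ?d y v"
      using y(1) that arcs_eq verts_eq by (intro ge1) auto
    then show ?thesis using y by simp
  qed
  obtain W where W: "W \<subseteq> X" "card W = 2 * k - 1"
    using k(2) obtain_subset_with_card_n by metis
  have finW: "finite W" using W(1) finite_X by (rule finite_subset)
  have st: "s \<in> verts G" "t \<in> verts G" using verts_eq by auto
  show ?thesis
  proof (rule le_c1_weighted)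
    show st_pos: "0 < ?d s t" using ge1[OF st] hubs_distinct by simp
    fix L L' :: real and \<phi>
    assume L: "0 \<le> L" "0 \<le> L'" and \<phi>: "\<And>v. v \<in> verts G \<Longrightarrow> \<phi> v \<in> ell1"
      and lip: "\<And>u v. u \<in> verts G \<Longrightarrow> v \<in> verts G \<Longrightarrow> ell1_dist (\<phi> u) (\<phi> v) \<le> L * ?d u v"
      and colip: "\<And>u v. u \<in> verts G \<Longrightarrow> v \<in> verts G \<Longrightarrow> ?d u v \<le> L' * ell1_dist (\<phi> u) (\<phi> v)"
    show "(3 * real k - 2) / (2 * real k - 1) \<le> L * L'"
    proof (cases "k = 1")
      case True
      have "?d s t \<le> L' * ell1_dist (\<phi> s) (\<phi> t)" using colip st by simp
      also have "\<dots> \<le> L' * (L * ?d s t)" using lip st L by (intro mult_left_mono) auto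
      finally have "1 * ?d s t \<le> (L * L') * ?d s t" by (simp add: mult_ac)
      then show ?thesis using True st_pos by simp
    next
      case False
      then have k2: "2 \<le> k" using k by simp
      have near: "ell1_dist (\<phi> h) (\<phi> x) \<le> L" if "h \<in> {s, t}" "x \<in> W" for h x
      proof -
        have x: "x \<in> X" using that W by auto
        then have "?d h x \<le> 1" using sp_dist_le_edge[of h x] that arcs_eq by auto
        then have "L * ?d h x \<le> L * 1" using L by (intro mult_left_mono)
        then show ?thesis using lip[of h x] that x verts_eq by auto
      qed
      have far: "2 \<le> L' * ell1_dist (\<phi> u) (\<phi> v)"
        if "u \<in> verts G" "v \<in> verts G" "u \<noteq> v" "(u, v) \<notin> arcs_ends G" for u v
        using ge2[OF that] colip[OF that(1,2)] by simp
      show ?thesis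
      proof (rule hypermetric_distortion_bound[OF k2 finW W(2), of s t "\<lambda>u v. ell1_dist (\<phi> u) (\<phi> v)"])
        show "s \<noteq> t" "s \<notin> W" "t \<notin> W" using hubs_distinct W by auto
        show "ell1_dist (\<phi> u) (\<phi> u) = 0" for u by (simp add: ell1_dist_def)
        show "ell1_dist (\<phi> u) (\<phi> v) = ell1_dist (\<phi> v) (\<phi> u)" for u v
          by (simp add: ell1_dist_def abs_minus_commute)
        fix b :: "'a \<Rightarrow> int" assume "(\<Sum>v\<in>insert s (insert t W). b v) = 1"
        then show "(\<Sum>u\<in>insert s (insert t W). \<Sum>v\<in>insert s (insert t W).
            real_of_int (b u * b v) * ell1_dist (\<phi> u) (\<phi> v)) \<le> 0"
          using finW W verts_eq \<phi> by (intro ell1_hypermetric) auto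
      next
        show "2 \<le> L' * ell1_dist (\<phi> s) (\<phi> t)"
          using hubs_distinct arcs_eq verts_eq by (intro far) auto
        show "2 \<le> L' * ell1_dist (\<phi> x) (\<phi> y)" if "x \<in> W" "y \<in> W" "x \<noteq> y" for x y
          using that W hubs_distinct arcs_eq verts_eq by (intro far) auto
      qed (use near L in auto)
    qed
  qed (fact st)+
qed

theorem theorem2:
  fixes n :: nat and G :: "('a, 'b) pre_digraph"
  assumes "n > 0" and "complete_bipartite_digraph 2 n G"
  shows "c1 G = ennreal ((3 * \<lceil>real n / 2\<rceil> - 2) / (2 * \<lceil>real n / 2\<rceil> - 1))"
proof -
  from assms(2) obtain U X where G: "graph G" and UX: "verts G = U \<union> X" "U \<inter> X = {}" "card U = 2"
      "card X = n" "arcs_ends G = U \<times> X \<union> X \<times> U"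
    by (auto simp: complete_bipartite_digraph_def)
  obtain s t where st: "U = {s, t}" "s \<noteq> t" using UX(3) by (auto simp: card_2_iff)
  have "X \<noteq> {}" using UX(4) assms(1) by auto
  have K: "weighted_K2n G w s t X" if "\<forall>e\<in>edges G. 0 \<le> w e" for w
  proof -
    have "strongly_connected G"
      by (rule bipartite_strongly_connected[OF G _ \<open>X \<noteq> {}\<close>, of s t]) (use UX st in auto)
    then show ?thesis
      using G UX st that
      by (auto simp: weighted_K2n_def weighted_K2n_axioms_def connected_weighted_graph_def
          connected_weighted_graph_axioms_def)
  qed
  define k where "k = (n + 1) div 2"
  have ceil: "\<lceil>real n / 2\<rceil> = int k" unfolding k_def by linarith
  have k: "1 \<le> k" "n \<le> 2 * k" "2 * k - 1 \<le> n" using assms(1) by (auto simp: k_def)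
  have "c1 G = ennreal ((3 * real k - 2) / (2 * real k - 1))"
  proof (rule antisym)
    \<comment> \<open>the balanced sets live in an index set of size \<open>2 * k\<close>, which exceeds \<open>n\<close> by one if \<open>n\<close> is odd\<close>
    show "c1 G \<le> ennreal ((3 * real k - 2) / (2 * real k - 1))"
      unfolding c1_def using weighted_K2n.c1_weighted_K2n_le[OF K] UX(4) k
      by (intro SUP_least) auto
    \<comment> \<open>if \<open>n\<close> is even, one vertex is left out of the hypermetric inequality\<close>
    show "ennreal ((3 * real k - 2) / (2 * real k - 1)) \<le> c1 G"
      unfolding c1_def using le_c1_weighted_unit_K2n[OF K] UX(4) k
      by (intro SUP_upper2[of "\<lambda>_. 1"]) auto
  qed
  then show ?thesis by (simp add: ceil)
qed

end
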